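(* Fix $\epsilon\in(0,1/8)$. Let $0<p_0<1/2$ and let $W:[0,1]^2\to[p_0,1-p_0]$ be symmetric and Lipschitz with least Lipschitz constant $L>0$. Let $G\sim\mathcal G(n,W)$, let $w=n^{-1/4}$ and $y=\lceil n^{1/2-\epsilon}\rceil$, and assume that the hypotheses $\mathrm{LLT}(w,y)$ and $\mathrm{COR}(w,y)$ (both stated in the context) hold. Then asymptotically almost surely (i.e. with probability tending to $1$ as $n\to\infty$, over both the types and the edges) $F(G)\ge n^{1/2-\epsilon}$.
   Context: For a graph $G$, $F(G)$ is the largest order (number of vertices) of a regular induced subgraph of $G$, where a graph is regular if all its degrees are equal. Model $\mathcal G(n,W)$: draw $x_1,\dots,x_n$ (the types) i.i.d. uniform on $[0,1]$; given $x=(x_1,\dots,x_n)$, join $i\sim j$ independently for distinct pairs, with probability $W(x_i,x_j)$. Probabilities $\mathbb P(\cdot\mid x)$ are conditional on the types, over the edge randomness only; "a.a.s. over types" means for all $x$ in an event whose probability under the type randomness tends to $1$ as $n\to\infty$. Window: fix $c_0\in[0,1-w]$ and let $B:=\{i:x_i\in[c_0,c_0+w]\}$, $M:=|B|$. For $S\subseteq B$ with $|S|=y$, let $A_S$ be the event that $G[S]$ is regular, $\mu_v(S):=\sum_{u\in S\setminus\{v\}}W(x_u,x_v)$ for $v\in S$, and $\bar\mu_S:=y^{-1}\sum_{v\in S}\mu_v(S)$. Hypothesis $\mathrm{LLT}(w,y)$ (local limit lower bound): there exist $c,C>0$ depending only on $p_0$ such that a.a.s. over types, for every $S\subseteq B$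 with $|S|=y$, with $t$ the least integer $\ge\bar\mu_S$ such that $ty$ is even, $$\mathbb P\bigl(G[S]\text{ is }t\text{-regular}\mid x\bigr)\ \ge\ \Bigl(\frac{c}{\sqrt y}\Bigr)^{y-1}\exp\Bigl(-\frac{C}{y}\sum_{v\in S}\bigl(t-\mu_v(S)\bigr)^2\Bigr).$$ Hypothesis $\mathrm{COR}(w,y)$ (correlation at sublinear overlap): there exists $C>0$ such that a.a.s. over types, uniformly over $S,S'\subseteq B$ with $|S|=|S'|=y$ and $\kappa:=|S\cap S'|\in[2,\,y/\sqrt{\log n}\,]$, $$\mathbb P(A_S\cap A_{S'}\mid x)\ \le\ (1+o(1))\,e^{C\kappa^2/y}\,\mathbb P(A_S\mid x)\,\mathbb P(A_{S'}\mid x),$$ where the $o(1)$ is uniform in $S,S'$ as $n\to\infty$. Logarithms are natural. *)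

theory Defs
  imports "HOL-Probability.Probability"
begin

text \<open>A simple graph is a vertex set \<open>V\<close> together with a set \<open>E\<close> of two-element
  subsets of \<open>V\<close>.\<close>

definition induced_edges :: "'a set set \<Rightarrow> 'a set \<Rightarrow> 'a set set" where
  "induced_edges E S = {e \<in> E. e \<subseteq> S}"

definition vdegree :: "'a set \<Rightarrow> 'a set set \<Rightarrow> 'a \<Rightarrow> nat" where
  "vdegree V E v = card {u \<in> V. {u, v} \<in> E}"

definition k_regular :: "nat \<Rightarrow> 'a set \<Rightarrow> 'a set set \<Rightarrow> bool" where
  "k_regular k V E \<longleftrightarrow> (\<forall>v\<in>V. vdegree V E v = k)"

definition regular_graph :: "'a set \<Rightarrow> 'a set set \<Rightarrow> bool" where
  "regular_graph V E \<longleftrightarrow> (\<exists>k. k_regular k V E)"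

definition max_regular_induced :: "'a set \<Rightarrow> 'a set set \<Rightarrow> nat" where
  "max_regular_induced V E =
     Max {card S |S. S \<subseteq> V \<and> regular_graph S (induced_edges E S)}"

text \<open>The types are points of the product of \<open>n\<close> copies of \<open>[0,1]\<close> with Lebesgue measure.
  The sample space is \<open>[0,1]\<close> itself rather than the real line, so that the values of \<open>W\<close>
  outside the unit square play no role, not even for measurability.\<close>

definition type_space :: "nat \<Rightarrow> (nat \<Rightarrow> real) measure" where
  "type_space n = (\<Pi>\<^sub>M i\<in>{1..n}. restrict_space lborel {0..1})"

definition vertex_pairs :: "nat \<Rightarrow> nat set set" where
  "vertex_pairs n = {e. e \<subseteq> {1..n} \<and> card e = 2}"

text \<open>The law of the edge set given the types. For \<open>e = {i, j}\<close> with \<open>i < j\<close> the edge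
  probability is \<open>W (x i) (x j)\<close>; since \<open>W\<close> is symmetric the orientation is immaterial.\<close>

definition edge_law ::
    "nat \<Rightarrow> (real \<Rightarrow> real \<Rightarrow> real) \<Rightarrow> (nat \<Rightarrow> real) \<Rightarrow> nat set set pmf" where
  "edge_law n W x =
     map_pmf (\<lambda>f. {e. f e})
       (Pi_pmf (vertex_pairs n) False (\<lambda>e. bernoulli_pmf (W (x (Min e)) (x (Max e)))))"

text \<open>The (unconditional) law of the edge set of \<open>G(n,W)\<close> on the vertex set \<open>{1..n}\<close>.\<close>

definition gnW :: "nat \<Rightarrow> (real \<Rightarrow> real \<Rightarrow> real) \<Rightarrow> nat set set measure" where
  "gnW n W = type_space n \<bind> (\<lambda>x. measure_pmf (edge_law n W x))"

definition aas_types :: "(nat \<Rightarrow> (nat \<Rightarrow> real) \<Rightarrow> bool) \<Rightarrow> bool" where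
  "aas_types P \<longleftrightarrow>
     (\<exists>A. (\<forall>n. A n \<in> sets (type_space n)) \<and>
          (\<lambda>n. measure (type_space n) (A n)) \<longlonglongrightarrow> 1 \<and>
          (\<forall>n. \<forall>x\<in>A n. P n x))"

definition window :: "nat \<Rightarrow> real \<Rightarrow> real \<Rightarrow> (nat \<Rightarrow> real) \<Rightarrow> nat set" where
  "window n c0 w x = {i \<in> {1..n}. x i \<in> {c0 .. c0 + w}}"

definition type_mu :: "(real \<Rightarrow> real \<Rightarrow> real) \<Rightarrow> (nat \<Rightarrow> real) \<Rightarrow> nat set \<Rightarrow> nat \<Rightarrow> real" where
  "type_mu W x S v = (\<Sum>u\<in>S - {v}. W (x u) (x v))"

definition type_mu_avg :: "(real \<Rightarrow> real \<Rightarrow> real) \<Rightarrow> (nat \<Rightarrow> real) \<Rightarrow> nat set \<Rightarrow> real" where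
  "type_mu_avg W x S = (\<Sum>v\<in>S. type_mu W x S v) / real (card S)"

text \<open>The average is nonnegative, so the least integer above it with the parity property is
  a natural number.\<close>

definition target_degree :: "(real \<Rightarrow> real \<Rightarrow> real) \<Rightarrow> (nat \<Rightarrow> real) \<Rightarrow> nat set \<Rightarrow> nat" where
  "target_degree W x S = (LEAST t. type_mu_avg W x S \<le> real t \<and> even (t * card S))"

definition regular_event :: "nat set \<Rightarrow> nat set set set" where
  "regular_event S = {E. regular_graph S (induced_edges E S)}"

text \<open>In both hypotheses the window position \<open>c0\<close>, the window width \<open>w\<close> and the set size \<open>y\<close>
  are functions of \<open>n\<close>. The constants are chosen before \<open>n\<close>, the types and the sets. The
  graphon \<open>W\<close> (and its lower bound \<open>p0\<close>) is fixed throughout, so constants depending only on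
  \<open>p0\<close> are in particular constants as required here.\<close>

definition LLT ::
    "(real \<Rightarrow> real \<Rightarrow> real) \<Rightarrow> (nat \<Rightarrow> real) \<Rightarrow> (nat \<Rightarrow> real) \<Rightarrow> (nat \<Rightarrow> nat) \<Rightarrow> bool" where
  "LLT W c0 w y \<longleftrightarrow>
     (\<exists>c>0. \<exists>C>0. aas_types (\<lambda>n x.
        \<forall>S. S \<subseteq> window n (c0 n) (w n) x \<and> card S = y n \<longrightarrow>
          measure_pmf.prob (edge_law n W x)
             {E. k_regular (target_degree W x S) S (induced_edges E S)}
          \<ge> (c / sqrt (real (y n))) ^ (y n - 1) *
             exp (- (C / real (y n)) *
                  (\<Sum>v\<in>S. (real (target_degree W x S) - type_mu W x S v)\<^sup>2))))"

definition COR ::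
    "(real \<Rightarrow> real \<Rightarrow> real) \<Rightarrow> (nat \<Rightarrow> real) \<Rightarrow> (nat \<Rightarrow> real) \<Rightarrow> (nat \<Rightarrow> nat) \<Rightarrow> bool" where
  "COR W c0 w y \<longleftrightarrow>
     (\<exists>C>0. \<exists>\<delta>::nat \<Rightarrow> real. \<delta> \<longlonglongrightarrow> 0 \<and> aas_types (\<lambda>n x.
        \<forall>S S'. S \<subseteq> window n (c0 n) (w n) x \<and> S' \<subseteq> window n (c0 n) (w n) x \<and>
               card S = y n \<and> card S' = y n \<and>
               2 \<le> card (S \<inter> S') \<and>
               real (card (S \<inter> S')) \<le> real (y n) / sqrt (ln (real n)) \<longrightarrow>
          measure_pmf.prob (edge_law n W x) (regular_event S \<inter> regular_event S')
          \<le> (1 + \<delta> n) * exp (C * (real (card (S \<inter> S')))\<^sup>2 / real (y n)) *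
             measure_pmf.prob (edge_law n W x) (regular_event S) *
             measure_pmf.prob (edge_law n W x) (regular_event S')))"

end

theory Submission
  imports Defs "HOL-Real_Asymp.Real_Asymp"
begin

text \<open>The proof is a second moment argument at fixed types. Let \<open>B\<close> be the set of vertices whose type lies
in the window, let \<open>M = |B|\<close>, which is at least half its mean \<open>n^(3/4)\<close> with high probability, and let
\<open>A(S)\<close> be the event that the vertex set \<open>S\<close> spans a regular graph. The probabilities of the events
\<open>A(S)\<close> may vary with \<open>S\<close>, so the sets are not counted with equal weight: the random variable
\<open>Z = \<Sum>\<^sub>S 1(A(S)) / P(A(S))\<close>, with \<open>S\<close> ranging over the \<open>y\<close>-subsets of \<open>B\<close>, has the number \<open>N\<close> of these
sets as its mean. Chebyshev's inequality bounds \<open>P(Z = 0)\<close> by the average, over pairs \<open>(S, S')\<close>, of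
\<open>P(A(S) \<inter> A(S')) / (P(A(S)) P(A(S'))) - 1\<close>. This ratio is controlled by \<open>k = |S \<inter> S'|\<close> alone.

If \<open>k \<le> 1\<close>, the two events depend on disjoint sets of vertex pairs and the ratio is \<open>1\<close>. If
\<open>2 \<le> k \<le> y / sqrt (ln n)\<close>, the correlation hypothesis bounds it by \<open>(1 + o(1)) exp (C k\<^sup>2 / y)\<close>.
For larger \<open>k\<close> there is a direct bound: given all edges except those between \<open>S' - S\<close> and \<open>S \<inter> S'\<close>,
a prescribed degree in \<open>S'\<close> of a vertex of \<open>S' - S\<close> prescribes the value of a sum of \<open>k\<close> independent
indicators, and these sums are independent for different vertices. Such a sum has no atom larger
than \<open>1 / sqrt (1 + p0 k)\<close>, so \<open>P(A(S) \<inter> A(S')) \<le> P(A(S)) (y + 1) (1 + p0 k)^(-(y-k)/2)\<close>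
(\<open>regular_overlap_le\<close>). The local limit hypothesis gives \<open>P(A(S')) \<ge> (c / sqrt y)\<^sup>y exp (- o(y))\<close>:
within the window the expected degrees differ by at most \<open>L w y + O(1)\<close>, and \<open>(w y)\<^sup>2 = o(y)\<close>.
Hence the ratio is at most \<open>y^(k/2)\<close> times \<open>exp (O(y ln (ln n)))\<close>.

The average over \<open>S'\<close> is handled by one inequality, \<open>E z^|S \<inter> S'| \<le> exp (z y\<^sup>2 / M)\<close> for \<open>z \<ge> 1\<close>
(\<open>sum_power_card_Int_le\<close>), since the ratio is dominated by a sum of a term near \<open>1\<close> and two powers
\<open>z\<^sup>k\<close> with small coefficients. The typical overlap \<open>y\<^sup>2 / M\<close> is of order \<open>n^(1/4-2\<epsilon>)\<close>. Put
\<open>k1 = n^(1/4-3\<epsilon>/4)\<close>: it is much larger than the typical overlap, while \<open>k1\<^sup>2 / y\<close> tends to \<open>0\<close>. Up to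
\<open>k1\<close> the factor \<open>exp (C k\<^sup>2 / y)\<close> is \<open>1 + o(1)\<close>; from \<open>k1\<close> to \<open>y / sqrt (ln n)\<close> it is at most
\<open>exp (- k1) exp (C + 1)\<^sup>k\<close>. In the large range, writing \<open>y^(k/2) = (y^(1/2) n\<^sup>\<epsilon>)\<^sup>k n^(-\<epsilon>k)\<close> gains a factor
\<open>n^(-\<epsilon>k) \<le> exp (- \<epsilon> y sqrt (ln n))\<close>, which beats \<open>exp (O(y ln (ln n)))\<close>, and the exponential moment
at \<open>z = y^(1/2) n\<^sup>\<epsilon>\<close> costs only \<open>exp (o(y))\<close>. All three contributions are estimated in
\<open>conditional_failure_le\<close> and evaluated in \<open>regular_subset_failure_le\<close>.\<close>

section \<open>Random subsets with independent elements\<close>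

text \<open>The edge set of the random graph is an instance with the vertex pairs as ground set. Working with
subsets rather than with indicator functions lets events be written in terms of \<open>E - T\<close> and
\<open>E \<inter> T\<close>.\<close>

definition random_subset :: "'a set \<Rightarrow> ('a \<Rightarrow> real) \<Rightarrow> 'a set pmf" where
  "random_subset A p = map_pmf Collect (Pi_pmf A False (\<lambda>e. bernoulli_pmf (p e)))"

lemma random_subset_empty: "random_subset {} p = return_pmf {}"
  by (simp add: random_subset_def)

lemma set_random_subset: "finite A \<Longrightarrow> set_pmf (random_subset A p) \<subseteq> Pow A"
  using set_Pi_pmf_subset[of A False "\<lambda>e. bernoulli_pmf (p e)"]
  by (auto simp: random_subset_def)

lemma random_subset_Un:
  assumes "finite A" "finite B" "A \<inter> B = {}"
  shows "random_subset (A \<union> B) p =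
    random_subset A p \<bind> (\<lambda>X. map_pmf (\<lambda>Y. X \<union> Y) (random_subset B p))"
proof -
  let ?P = "\<lambda>A. Pi_pmf A False (\<lambda>e. bernoulli_pmf (p e))"
  have "random_subset (A \<union> B) p =
      map_pmf (\<lambda>(f, g). Collect (\<lambda>x. if x \<in> A then f x else g x)) (pair_pmf (?P A) (?P B))"
    by (simp add: random_subset_def Pi_pmf_union[OF assms] map_pmf_comp case_prod_unfold)
  also have "\<dots> = map_pmf (\<lambda>(f, g). Collect f \<union> Collect g) (pair_pmf (?P A) (?P B))"
  proof (rule map_pmf_cong[OF refl])
    fix q assume "q \<in> set_pmf (pair_pmf (?P A) (?P B))"
    then obtain f g where q: "q = (f, g)" "f \<in> set_pmf (?P A)" "g \<in> set_pmf (?P B)" by auto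
    have "\<forall>x. x \<notin> A \<longrightarrow> \<not> f x" "\<forall>x. x \<notin> B \<longrightarrow> \<not> g x"
      using q(2,3) set_Pi_pmf_subset[OF assms(1), of False "\<lambda>e. bernoulli_pmf (p e)"]
        set_Pi_pmf_subset[OF assms(2), of False "\<lambda>e. bernoulli_pmf (p e)"] by auto
    then show "(case q of (f, g) \<Rightarrow> {x. if x \<in> A then f x else g x}) =
        (case q of (f, g) \<Rightarrow> Collect f \<union> Collect g)"
      using assms(3) q by auto
  qed
  also have "\<dots> = random_subset A p \<bind> (\<lambda>X. map_pmf (\<lambda>Y. X \<union> Y) (random_subset B p))"
    by (simp add: random_subset_def pair_pmf_def map_pmf_def bind_assoc_pmf bind_return_pmf)
  finally show ?thesis .
qed

lemma expectation_random_subset_insert: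
  fixes h :: "'a set \<Rightarrow> real"
  assumes "finite A" "e \<notin> A" "0 \<le> p e" "p e \<le> 1"
  shows "measure_pmf.expectation (random_subset (insert e A) p) h =
    p e * measure_pmf.expectation (random_subset A p) (\<lambda>X. h (insert e X))
    + (1 - p e) * measure_pmf.expectation (random_subset A p) h"
proof -
  have "random_subset {e} p = map_pmf (\<lambda>b. if b then {e} else {}) (bernoulli_pmf (p e))"
  proof -
    have "Collect (\<lambda>b'. if b' = e then b else False) = (if b then {e} else {})" for b
      by auto
    then show ?thesis
      by (simp only: random_subset_def Pi_pmf_singleton map_pmf_comp o_def)
  qed
  then have "random_subset (insert e A) p = bernoulli_pmf (p e) \<bind>
      (\<lambda>b. map_pmf (\<lambda>Y. (if b then {e} else {}) \<union> Y) (random_subset A p))"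
    using random_subset_Un[of "{e}" A p] assms by (simp add: bind_map_pmf)
  then have "measure_pmf.expectation (random_subset (insert e A) p) h =
      (\<Sum>b\<in>UNIV. pmf (bernoulli_pmf (p e)) b *\<^sub>R measure_pmf.expectation
        (map_pmf (\<lambda>Y. (if b then {e} else {}) \<union> Y) (random_subset A p)) h)"
    using finite_subset[OF set_random_subset[OF assms(1)]] assms(1)
    by (simp only:, intro pmf_expectation_bind) auto
  then show ?thesis
    using assms by (simp add: UNIV_bool)
qed

text \<open>Conditioning on the part outside \<open>T\<close>: by independence the part inside \<open>T\<close> keeps its law.\<close>

lemma emeasure_random_subset_split:
  assumes "finite A" "T \<subseteq> A"
  shows "emeasure (random_subset A p) {E. \<Phi> E} =
    (\<integral>\<^sup>+X. emeasure (random_subset T p) {Y. \<Phi> (X \<union> Y)} \<partial>random_subset (A - T) p)"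
proof -
  have "random_subset A p = random_subset ((A - T) \<union> T) p"
    using assms by (simp add: Un_absorb2)
  also have "\<dots> = random_subset (A - T) p \<bind> (\<lambda>X. map_pmf (\<lambda>Y. X \<union> Y) (random_subset T p))"
    using assms by (intro random_subset_Un) (auto intro: finite_subset)
  finally show ?thesis by (simp add: vimage_def)
qed

lemma random_subset_ignore:
  assumes "finite A" "T \<subseteq> A" and Q: "\<And>E. Q E \<longleftrightarrow> Q (E - T)"
  shows "emeasure (random_subset A p) {E. Q E} = emeasure (random_subset (A - T) p) {E. Q E}"
proof -
  have fin: "finite T" using assms(1,2) finite_subset by auto
  have *: "Q (X \<union> Y) \<longleftrightarrow> Q X" if "Y \<in> set_pmf (random_subset T p)" for X Y
  proof -
    have "Y \<subseteq> T" using that set_random_subset[OF fin, of p] by auto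
    then have "(X \<union> Y) - T = X - T" by auto
    then show ?thesis using Q[of "X \<union> Y"] Q[of X] by metis
  qed
  have "emeasure (random_subset T p) {Y. Q (X \<union> Y)} = emeasure (random_subset T p) {Y. Q X}" for X
    using * by (intro emeasure_eq_AE) (auto simp: AE_measure_pmf_iff)
  then have "emeasure (random_subset T p) {Y. Q (X \<union> Y)} = indicator {X. Q X} X" for X
    by (auto simp: indicator_def measure_pmf.emeasure_eq_measure)
  then show ?thesis
    unfolding emeasure_random_subset_split[OF assms(1,2)] by simp
qed

text \<open>\<open>Q'\<close> is asked to ignore the elements outside \<open>T\<close> only for subsets of \<open>A\<close>: an event about the edges
inside a vertex set would otherwise also see sets that are not vertex pairs.\<close>

lemma random_subset_indep:
  assumes "finite A" "T \<subseteq> A"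
    and Q: "\<And>E. Q E \<longleftrightarrow> Q (E - T)" and Q': "\<And>E. E \<subseteq> A \<Longrightarrow> Q' E \<longleftrightarrow> Q' (E \<inter> T)"
  shows "measure_pmf.prob (random_subset A p) {E. Q E \<and> Q' E} =
    measure_pmf.prob (random_subset A p) {E. Q E} * measure_pmf.prob (random_subset A p) {E. Q' E}"
proof -
  let ?P = "random_subset A p" and ?R = "random_subset (A - T) p" and ?T = "random_subset T p"
  have fin: "finite T" "finite (A - T)" using assms(1,2) finite_subset by auto
  have *: "Q (X \<union> Y) \<longleftrightarrow> Q X" "Q' (X \<union> Y) \<longleftrightarrow> Q' Y" if "X \<in> set_pmf ?R" "Y \<in> set_pmf ?T" for X Y
  proof -
    have "X \<subseteq> A - T" "Y \<subseteq> T"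
      using that set_random_subset[OF fin(1), of p] set_random_subset[OF fin(2), of p] by auto
    then have "(X \<union> Y) - T = X - T" "(X \<union> Y) \<inter> T = Y \<inter> T" "X \<union> Y \<subseteq> A" "Y \<subseteq> A"
      using assms(2) by auto
    then show "Q (X \<union> Y) \<longleftrightarrow> Q X" "Q' (X \<union> Y) \<longleftrightarrow> Q' Y"
      using Q[of "X \<union> Y"] Q[of X] Q'[of "X \<union> Y"] Q'[of Y] by metis+
  qed
  have "emeasure ?P {E. Q E \<and> Q' E} = (\<integral>\<^sup>+X. indicator {X. Q X} X * emeasure ?T {Y. Q' Y} \<partial>?R)"
    unfolding emeasure_random_subset_split[OF assms(1,2)]
  proof (intro nn_integral_cong_AE, unfold AE_measure_pmf_iff, intro ballI)
    fix X assume X: "X \<in> set_pmf ?R"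
    have "emeasure ?T {Y. Q (X \<union> Y) \<and> Q' (X \<union> Y)} = emeasure ?T {Y. Q X \<and> Q' Y}"
      using * X by (intro emeasure_eq_AE) (auto simp: AE_measure_pmf_iff)
    then show "emeasure ?T {Y. Q (X \<union> Y) \<and> Q' (X \<union> Y)} = indicator {X. Q X} X * emeasure ?T {Y. Q' Y}"
      by (auto simp: indicator_def)
  qed
  then have 1: "emeasure ?P {E. Q E \<and> Q' E} = emeasure ?R {X. Q X} * emeasure ?T {Y. Q' Y}"
    by (simp add: nn_integral_multc)
  have 2: "emeasure ?P {E. Q' E} = emeasure ?T {Y. Q' Y}"
  proof -
    have "Q' E \<longleftrightarrow> Q' (E - (A - T))" if "E \<in> set_pmf ?P" for E
    proof -
      have "E \<subseteq> A" using that set_random_subset[OF assms(1), of p] by auto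
      then have "E - (A - T) = E \<inter> T" using assms(2) by auto
      then show ?thesis using Q' \<open>E \<subseteq> A\<close> by metis
    qed
    then have "emeasure ?P {E. Q' E} = emeasure ?P {E. Q' (E - (A - T))}"
      by (intro emeasure_eq_AE) (auto simp: AE_measure_pmf_iff)
    also have "\<dots> = emeasure (random_subset (A - (A - T)) p) {E. Q' (E - (A - T))}"
      using assms(1) by (intro random_subset_ignore) auto
    also have "A - (A - T) = T" using assms(2) by auto
    also have "emeasure ?T {E. Q' (E - (A - T))} = emeasure ?T {E. Q' E}"
    proof (intro emeasure_eq_AE)
      have "E - (A - T) = E" if "E \<in> set_pmf ?T" for E
        using that set_random_subset[OF fin(1), of p] by auto
      then show "AE E in ?T. E \<in> {E. Q' (E - (A - T))} \<longleftrightarrow> E \<in> {E. Q' E}"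
        by (auto simp: AE_measure_pmf_iff)
    qed auto
    finally show ?thesis .
  qed
  have 3: "emeasure ?P {E. Q E} = emeasure ?R {E. Q E}"
    by (rule random_subset_ignore[of A T Q, OF assms(1,2) Q])
  show ?thesis
    using 1 unfolding 2[symmetric] 3[symmetric]
    by (simp add: measure_pmf.emeasure_eq_measure flip: ennreal_mult)
qed

section \<open>Atoms of sums of independent indicators\<close>

text \<open>The probability that a sum of \<open>j\<close> fair coins equals \<open>k\<close>. Integer \<open>k\<close> makes the recursion
\<open>fair_atom_Suc\<close> hold without side conditions.\<close>

definition fair_atom :: "nat \<Rightarrow> int \<Rightarrow> real" where
  "fair_atom j k = (if k < 0 then 0 else real (j choose nat k) / 2 ^ j)"

lemma fair_atom_Suc: "fair_atom (Suc j) k = (fair_atom j k + fair_atom j (k - 1)) / 2"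
proof (cases "k \<le> 0")
  case True then show ?thesis by (auto simp: fair_atom_def)
next
  case False
  then obtain m where m: "k = int (Suc m)"
    by (metis nat_0_iff not0_implies_Suc nat_eq_iff2 linorder_not_le)
  have "nat (1 + int m) = Suc m" "nat (int (Suc m) - 1) = m" by auto
  then show ?thesis by (simp add: fair_atom_def m field_simps)
qed

text \<open>The factor \<open>2 n + 1\<close> is chosen to make the induction close: it reduces to
\<open>(2 n + 1) (2 n + 3) \<le> 4 (n + 1)\<^sup>2\<close>.\<close>

lemma central_binomial_even_bound: "(real ((2 * n) choose n))\<^sup>2 * (2 * real n + 1) \<le> 16 ^ n"
proof (induction n)
  case 0 then show ?case by simp
next
  case (Suc n)
  have "Suc n * (Suc (2 * n + 1) choose Suc n) = Suc (2 * n + 1) * ((2 * n + 1) choose n)"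
    by (simp only: Suc_times_binomial_eq mult.commute)
  then have "real (Suc n) * real (Suc (2 * n + 1) choose Suc n) = real (Suc (2 * n + 1)) * real ((2 * n + 1) choose n)"
    by (metis of_nat_mult)
  then have 1: "(real n + 1) * real (2 * Suc n choose Suc n) = 2 * (real n + 1) * real ((2 * n + 1) choose n)"
    by (simp add: add.commute del: binomial_Suc_Suc)
  have "Suc n * (Suc (2 * n) choose Suc n) = Suc (2 * n) * ((2 * n) choose n)"
    by (simp only: Suc_times_binomial_eq mult.commute)
  moreover have "(Suc (2 * n) choose Suc n) = ((2 * n + 1) choose n)"
    by (subst binomial_symmetric) auto
  ultimately have "real (Suc n) * real ((2 * n + 1) choose n) = real (Suc (2 * n)) * real ((2 * n) choose n)"
    by (metis of_nat_mult)
  then have 2: "(real n + 1) * real ((2 * n + 1) choose n) = (2 * real n + 1) * real ((2 * n) choose n)"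
    by (simp add: add.commute del: binomial_Suc_Suc)
  define c d where "c = real ((2 * n) choose n)" and "d = real (2 * Suc n choose Suc n)"
  have "(real n + 1) * d = 2 * ((2 * real n + 1) * c)"
    using 1 2 unfolding c_def d_def by (simp only: ring_distribs mult.assoc)
  then have sq: "(real n + 1)\<^sup>2 * d\<^sup>2 = 4 * (2 * real n + 1)\<^sup>2 * c\<^sup>2"
    by algebra
  have "(real n + 1)\<^sup>2 * (d\<^sup>2 * (2 * real n + 3)) = 4 * (2 * real n + 1) * (2 * real n + 3) * (c\<^sup>2 * (2 * real n + 1))"
    using arg_cong[OF sq, of "\<lambda>t. t * (2 * real n + 3)"] by (simp add: mult_ac power2_eq_square)
  also have "\<dots> \<le> 4 * (2 * real n + 1) * (2 * real n + 3) * 16 ^ n"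
    using Suc by (intro mult_left_mono) (auto simp: c_def)
  also have "\<dots> \<le> (16 * (real n + 1)\<^sup>2) * 16 ^ n"
    by (intro mult_right_mono) (auto simp: power2_eq_square algebra_simps)
  finally have "(real n + 1)\<^sup>2 * (d\<^sup>2 * (2 * real n + 3)) \<le> (real n + 1)\<^sup>2 * 16 ^ Suc n"
    by (simp add: mult_ac)
  then have "d\<^sup>2 * (2 * real n + 3) \<le> 16 ^ Suc n"
    by (subst (asm) mult_le_cancel_left_pos) auto
  then show ?case by (simp add: d_def algebra_simps)
qed

lemma fair_atom_le: "fair_atom j k \<le> 1 / sqrt (1 + real j)"
proof -
  have central: "(real (j choose (j div 2)))\<^sup>2 * (1 + real j) \<le> 4 ^ j"
  proof (cases "even j")
    case True
    then obtain n where "j = 2 * n" by (elim evenE)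
    then show ?thesis using central_binomial_even_bound[of n] by (simp add: power_mult add.commute)
  next
    case False
    then obtain n where j: "j = 2 * n + 1" by (elim oddE)
    have "2 * Suc n choose Suc n = 2 * ((2 * n + 1) choose n)"
      using binomial_symmetric[of "Suc n" "2 * n + 1"] by simp
    then have "real (2 * Suc n choose Suc n) = 2 * real ((2 * n + 1) choose n)"
      by (metis of_nat_mult of_nat_numeral)
    then have "(2 * real ((2 * n + 1) choose n))\<^sup>2 * (2 * real (Suc n) + 1) \<le> 16 ^ Suc n"
      using central_binomial_even_bound[of "Suc n"] by metis
    then have "4 * ((real ((2 * n + 1) choose n))\<^sup>2 * (2 * real n + 3)) \<le> 16 * 16 ^ n"
      by (simp only: power_mult_distrib of_nat_Suc) (simp add: add.commute mult.assoc)
    moreover have "(real ((2 * n + 1) choose n))\<^sup>2 * (2 * real n + 2) \<le> (real ((2 * n + 1) choose n))\<^sup>2 * (2 * real n + 3)"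
      by (intro mult_left_mono) auto
    ultimately have "(real ((2 * n + 1) choose n))\<^sup>2 * (2 * real n + 2) \<le> 4 * 16 ^ n"
      by linarith
    then show ?thesis by (simp add: j power_mult add.commute del: binomial_Suc_Suc)
  qed
  have "real (j choose (j div 2)) * sqrt (1 + real j) \<le> 2 ^ j"
  proof (rule power2_le_imp_le)
    show "(real (j choose (j div 2)) * sqrt (1 + real j))\<^sup>2 \<le> (2 ^ j)\<^sup>2"
    proof -
      have "(2 ^ j)\<^sup>2 = (4::real) ^ j"
        by (simp add: power2_eq_square flip: power_mult_distrib)
      then show ?thesis using central by (simp add: power_mult_distrib)
    qed
  qed auto
  then have "real (j choose (j div 2)) / 2 ^ j \<le> 1 / sqrt (1 + real j)"
    by (simp add: field_simps)
  moreover have "fair_atom j k \<le> real (j choose (j div 2)) / 2 ^ j"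
    using binomial_maximum[of j "nat k"] by (auto simp: fair_atom_def intro!: divide_right_mono)
  ultimately show ?thesis by linarith
qed

text \<open>The function \<open>1 / sqrt\<close> is convex, so moving from \<open>s\<close> to \<open>s + 1\<close> with weight \<open>2 a\<close> gives more
than its value at \<open>s + 2 a\<close>. Giving up half of the drift is enough to reverse the inequality.\<close>

lemma inverse_sqrt_mixture_le:
  fixes a s :: real
  assumes "0 \<le> a" "a \<le> 1" "1 \<le> s"
  shows "2 * a * (1 / sqrt (s + 1)) + (1 - 2 * a) * (1 / sqrt s) \<le> 1 / sqrt (s + a)"
proof -
  have "sqrt s / sqrt (s + 1) \<le> 1 - 1 / (4 * s)"
  proof (rule power2_le_imp_le)
    have "s / (s + 1) \<le> 1 - 1 / (2 * s)"
      using assms by (simp add: field_simps)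
    also have "\<dots> \<le> (1 - 1 / (4 * s))\<^sup>2"
      using assms by (simp add: power2_eq_square field_simps)
    finally show "(sqrt s / sqrt (s + 1))\<^sup>2 \<le> (1 - 1 / (4 * s))\<^sup>2"
      using assms by (simp add: power_divide)
    show "0 \<le> 1 - 1 / (4 * s)" using assms by (simp add: field_simps)
  qed
  then have 1: "2 * a * (sqrt s / sqrt (s + 1)) \<le> 2 * a * (1 - 1 / (4 * s))"
    using assms by (intro mult_left_mono) auto
  have 2: "1 - a / (2 * s) \<le> sqrt s / sqrt (s + a)"
  proof (rule power2_le_imp_le)
    define u where "u = a / s"
    have u: "0 \<le> u" "u \<le> 1" using assms by (auto simp: u_def field_simps)
    have "(1 - u / 2)\<^sup>2 * (1 + u) = 1 - u * u * ((3 - u) / 4)"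
      by (simp add: power2_eq_square field_simps)
    also have "\<dots> \<le> 1" using u by simp
    finally have "(1 - u / 2)\<^sup>2 \<le> 1 / (1 + u)" using u by (simp add: field_simps)
    also have "1 / (1 + u) = s / (s + a)" using assms by (simp add: u_def field_simps)
    finally show "(1 - a / (2 * s))\<^sup>2 \<le> (sqrt s / sqrt (s + a))\<^sup>2"
      using assms by (simp add: power_divide u_def mult.commute)
  qed (use assms in auto)
  have "2 * a * (sqrt s / sqrt (s + 1)) + (1 - 2 * a) \<le> sqrt s / sqrt (s + a)"
    using 1 2 assms by (simp add: algebra_simps)
  then have "(2 * a * (sqrt s / sqrt (s + 1)) + (1 - 2 * a)) / sqrt s \<le> sqrt s / sqrt (s + a) / sqrt s"
    using assms by (intro divide_right_mono) auto
  then show ?thesis using assms by (simp add: add_divide_distrib)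
qed

text \<open>An indicator with success probability in \<open>[a, 1 - a]\<close> is a mixture: with probability \<open>2 a\<close> it is a
fair coin, otherwise it is \<open>0\<close> or \<open>1\<close> with suitable weights. A constant only shifts the sum, while a
fair coin raises \<open>j\<close> by one. This turns the concentration of a general sum of indicators into that of
sums of fair coins, where \<open>j\<close> counts the fair coins already collected.\<close>

lemma expectation_fair_atom_le:
  assumes "finite A" "0 \<le> a" "a \<le> 1" "\<And>e. e \<in> A \<Longrightarrow> p e \<in> {a..1 - a}"
  shows "measure_pmf.expectation (random_subset A p) (\<lambda>X. fair_atom j (k - int (card X)))
    \<le> 1 / sqrt (1 + real j + a * real (card A))"
  using assms(1,4)
proof (induction A arbitrary: j k rule: finite_induct)
  case empty
  then show ?case by (simp add: random_subset_empty fair_atom_le)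
next
  case (insert e A)
  let ?P = "random_subset A p"
  let ?I = "\<lambda>j k. measure_pmf.expectation ?P (\<lambda>X. fair_atom j (k - int (card X)))"
  have pe: "a \<le> p e" "p e \<le> 1 - a" using insert.prems by auto
  have fin: "finite (set_pmf ?P)"
    using finite_subset[OF set_random_subset] insert.hyps(1) by blast
  have int: "integrable (measure_pmf ?P) h" for h :: "'a set \<Rightarrow> real"
    by (rule integrable_measure_pmf_finite[OF fin])
  have card_ins: "card (insert e X) = Suc (card X)" if "X \<in> set_pmf ?P" for X
  proof -
    have "X \<subseteq> A" using that set_random_subset[OF insert.hyps(1), of p] by auto
    then show ?thesis using insert.hyps by (metis card_insert_disjoint finite_subset subsetD)
  qed
  \<comment> \<open>A success of \<open>e\<close> lowers the target of the remaining sum by one.\<close>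
  have shift: "measure_pmf.expectation ?P (\<lambda>X. fair_atom j (k - int (card (insert e X)))) = ?I j (k - 1)"
    using card_ins by (intro Bochner_Integration.integral_cong_AE) (auto simp: AE_measure_pmf_iff algebra_simps)
  have half: "?I (Suc j) k = (?I j k + ?I j (k - 1)) / 2"
  proof -
    have "?I (Suc j) k = measure_pmf.expectation ?P
        (\<lambda>X. (fair_atom j (k - int (card X)) + fair_atom j (k - 1 - int (card X))) / 2)"
      by (simp add: fair_atom_Suc algebra_simps)
    then show ?thesis by (simp add: int)
  qed
  define s where "s = 1 + real j + a * real (card A)"
  have s: "1 \<le> s" using assms(2) by (simp add: s_def)
  have IH: "?I j k \<le> 1 / sqrt s" "?I j (k - 1) \<le> 1 / sqrt s" "?I (Suc j) k \<le> 1 / sqrt (s + 1)"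
    using insert.IH[of j k] insert.IH[of j "k - 1"] insert.IH[of "Suc j" k] insert.prems
    by (auto simp: s_def algebra_simps)
  have "measure_pmf.expectation (random_subset (insert e A) p) (\<lambda>X. fair_atom j (k - int (card X)))
      = p e * ?I j (k - 1) + (1 - p e) * ?I j k"
    using insert.hyps pe assms(2) by (subst expectation_random_subset_insert) (auto simp: shift)
  \<comment> \<open>The fair coin is split off with weight \<open>2 * a\<close>; the remaining weights are nonnegative.\<close>
  also have "\<dots> = 2 * a * ?I (Suc j) k + (p e - a) * ?I j (k - 1) + (1 - a - p e) * ?I j k"
    unfolding half by (simp add: algebra_simps)
  also have "\<dots> \<le> 2 * a * (1 / sqrt (s + 1)) + (p e - a) * (1 / sqrt s) + (1 - a - p e) * (1 / sqrt s)"
    using IH pe assms(2) by (intro add_mono mult_left_mono) auto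
  also have "\<dots> = 2 * a * (1 / sqrt (s + 1)) + (1 - 2 * a) * (1 / sqrt s)"
    by (simp add: diff_divide_distrib)
  also have "\<dots> \<le> 1 / sqrt (s + a)"
    by (rule inverse_sqrt_mixture_le[OF assms(2,3) s])
  also have "s + a = 1 + real j + a * real (card (insert e A))"
    using insert.hyps by (simp add: s_def algebra_simps)
  finally show ?case .
qed

lemma prob_card_random_subset_le:
  assumes "finite A" "0 \<le> a" "a \<le> 1" "\<And>e. e \<in> A \<Longrightarrow> p e \<in> {a..1 - a}"
  shows "measure_pmf.prob (random_subset A p) {X. card X = k} \<le> 1 / sqrt (1 + a * real (card A))"
proof -
  have "measure_pmf.prob (random_subset A p) {X. card X = k}
      = measure_pmf.expectation (random_subset A p) (indicator {X. card X = k})" by simp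
  also have "(indicator {X. card X = k} :: 'a set \<Rightarrow> real) = (\<lambda>X. fair_atom 0 (int k - int (card X)))"
    by (auto simp: fun_eq_iff indicator_def fair_atom_def binomial_eq_0)
  also have "measure_pmf.expectation (random_subset A p) \<dots> \<le> 1 / sqrt (1 + real 0 + a * real (card A))"
    by (rule expectation_fair_atom_le[OF assms])
  finally show ?thesis by simp
qed

section \<open>Regularity of overlapping vertex sets\<close>

text \<open>Given the part outside \<open>T\<close> the target \<open>k E\<close> is a constant, so the bound on single atoms applies.\<close>

lemma prob_card_block_le:
  assumes "finite A" "T \<subseteq> A" "0 \<le> a" "a \<le> 1" "\<And>e. e \<in> A \<Longrightarrow> p e \<in> {a..1 - a}"
    and Q: "\<And>E. Q E \<longleftrightarrow> Q (E - T)" and k: "\<And>E. k E = k (E - T)"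
  shows "measure_pmf.prob (random_subset A p) {E. Q E \<and> card (E \<inter> T) = k E}
    \<le> measure_pmf.prob (random_subset A p) {E. Q E} * (1 / sqrt (1 + a * real (card T)))"
proof -
  let ?b = "1 / sqrt (1 + a * real (card T))" and ?R = "random_subset (A - T) p"
  have fin: "finite T" "finite (A - T)" using assms(1,2) finite_subset by auto
  have b: "0 \<le> ?b" using assms(3) by simp
  have "emeasure (random_subset A p) {E. Q E \<and> card (E \<inter> T) = k E}
      = (\<integral>\<^sup>+X. emeasure (random_subset T p) {Y. Q (X \<union> Y) \<and> card ((X \<union> Y) \<inter> T) = k (X \<union> Y)} \<partial>?R)"
    by (rule emeasure_random_subset_split[OF assms(1,2)])
  also have "\<dots> \<le> (\<integral>\<^sup>+X. indicator {X. Q X} X * ennreal ?b \<partial>?R)"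
  proof (intro nn_integral_mono_AE, unfold AE_measure_pmf_iff, intro ballI)
    fix X assume "X \<in> set_pmf ?R"
    then have X: "X \<subseteq> A - T" using set_random_subset[OF fin(2), of p] by auto
    have *: "(Q (X \<union> Y) \<and> card ((X \<union> Y) \<inter> T) = k (X \<union> Y)) \<longleftrightarrow> (Q X \<and> card Y = k X)"
      if "Y \<in> set_pmf (random_subset T p)" for Y
    proof -
      have "Y \<subseteq> T" using that set_random_subset[OF fin(1), of p] by auto
      then have "(X \<union> Y) - T = X - T" "(X \<union> Y) \<inter> T = Y" using X by auto
      then show ?thesis using Q[of "X \<union> Y"] Q[of X] k[of "X \<union> Y"] k[of X] by metis
    qed
    have "emeasure (random_subset T p) {Y. Q (X \<union> Y) \<and> card ((X \<union> Y) \<inter> T) = k (X \<union> Y)}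
        = emeasure (random_subset T p) {Y. Q X \<and> card Y = k X}"
      using * by (intro emeasure_eq_AE) (auto simp: AE_measure_pmf_iff)
    also have "\<dots> \<le> indicator {X. Q X} X * ennreal ?b"
    proof (cases "Q X")
      case True
      have "measure_pmf.prob (random_subset T p) {Y. card Y = k X} \<le> ?b"
        using assms(2,5) by (intro prob_card_random_subset_le fin(1) assms(3,4)) auto
      then show ?thesis using True b by (simp add: measure_pmf.emeasure_eq_measure ennreal_leI)
    qed simp
    finally show "emeasure (random_subset T p) {Y. Q (X \<union> Y) \<and> card ((X \<union> Y) \<inter> T) = k (X \<union> Y)}
        \<le> indicator {X. Q X} X * ennreal ?b" .
  qed
  also have "\<dots> = emeasure ?R {X. Q X} * ennreal ?b"
    by (simp add: nn_integral_multc)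
  also have "emeasure ?R {X. Q X} = emeasure (random_subset A p) {E. Q E}"
    by (rule random_subset_ignore[of A T Q, OF assms(1,2) Q, symmetric])
  finally show ?thesis
    using b by (simp add: measure_pmf.emeasure_eq_measure flip: ennreal_mult)
qed

text \<open>The blocks are removed one at a time. The prescribed cardinality \<open>k v\<close> may depend on the random set,
but only outside all blocks, so each block in turn meets its target with probability at most the
largest atom, whatever the rest looks like.\<close>

lemma prob_card_blocks_le:
  fixes T :: "'i \<Rightarrow> 'a set"
  assumes "finite V" "finite A" "0 \<le> a" "a \<le> 1" "\<And>e. e \<in> A \<Longrightarrow> p e \<in> {a..1 - a}"
    and "\<And>v. v \<in> V \<Longrightarrow> T v \<subseteq> A" "\<And>v. v \<in> V \<Longrightarrow> card (T v) = m"
    and "\<And>u v. u \<in> V \<Longrightarrow> v \<in> V \<Longrightarrow> u \<noteq> v \<Longrightarrow> T u \<inter> T v = {}"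
    and "\<And>E. Q E \<longleftrightarrow> Q (E - (\<Union>v\<in>V. T v))"
    and "\<And>v E. v \<in> V \<Longrightarrow> k v E = k v (E - (\<Union>v\<in>V. T v))"
  shows "measure_pmf.prob (random_subset A p) {E. Q E \<and> (\<forall>v\<in>V. card (E \<inter> T v) = k v E)}
    \<le> measure_pmf.prob (random_subset A p) {E. Q E} * (1 / sqrt (1 + a * real m)) ^ card V"
  using assms(1,6-)
proof (induction V rule: finite_induct)
  case empty then show ?case by simp
next
  case (insert v V)
  let ?P = "random_subset A p" and ?b = "1 / sqrt (1 + a * real m)" and ?U = "\<Union>u\<in>insert v V. T u"
  have b: "0 \<le> ?b" using assms(3) by simp
  have Qsub: "Q E \<longleftrightarrow> Q (E - D)" if "D \<subseteq> ?U" for D E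
  proof -
    have "(E - D) - ?U = E - ?U" using that by auto
    then show ?thesis using insert.prems(4)[of E] insert.prems(4)[of "E - D"] by metis
  qed
  have ksub: "k u E = k u (E - D)" if "D \<subseteq> ?U" "u \<in> insert v V" for D E u
  proof -
    have "(E - D) - ?U = E - ?U" using that by auto
    then show ?thesis using insert.prems(5)[OF that(2), of E] insert.prems(5)[OF that(2), of "E - D"] by metis
  qed
  let ?Q' = "\<lambda>E. Q E \<and> (\<forall>u\<in>V. card (E \<inter> T u) = k u E)"
  have "measure_pmf.prob ?P {E. Q E \<and> (\<forall>u\<in>insert v V. card (E \<inter> T u) = k u E)}
      = measure_pmf.prob ?P {E. ?Q' E \<and> card (E \<inter> T v) = k v E}"
    by (rule arg_cong[where f = "measure_pmf.prob ?P"]) auto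
  also have "\<dots> \<le> measure_pmf.prob ?P {E. ?Q' E} * (1 / sqrt (1 + a * real (card (T v))))"
  proof (rule prob_card_block_le[OF assms(2) _ assms(3-5)])
    show "T v \<subseteq> A" using insert.prems(1) by simp
    show "k v E = k v (E - T v)" for E by (rule ksub) auto
    show "?Q' E \<longleftrightarrow> ?Q' (E - T v)" for E
    proof -
      have "(E - T v) \<inter> T u = E \<inter> T u" if "u \<in> V" for u
        using insert.prems(3)[of u v] insert.hyps(2) that by auto
      moreover have "k u E = k u (E - T v)" if "u \<in> V" for u by (rule ksub) (use that in auto)
      moreover have "Q E \<longleftrightarrow> Q (E - T v)" by (rule Qsub) auto
      ultimately show ?thesis by auto
    qed
  qed
  also have "card (T v) = m" using insert.prems(2) by simp
  also have "measure_pmf.prob ?P {E. ?Q' E} * ?b \<le> (measure_pmf.prob ?P {E. Q E} * ?b ^ card V) * ?b"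
  proof (rule mult_right_mono[OF insert.IH b])
    show "Q E \<longleftrightarrow> Q (E - (\<Union>u\<in>V. T u))" for E by (rule Qsub) auto
    show "k u E = k u (E - (\<Union>u\<in>V. T u))" if "u \<in> V" for u E by (rule ksub) (use that in auto)
  qed (use insert.prems(1-3) in auto)
  also have "\<dots> = measure_pmf.prob ?P {E. Q E} * ?b ^ card (insert v V)"
    using insert.hyps by simp
  finally show ?case .
qed

lemma regular_event_cong:
  assumes "induced_edges E S = induced_edges E' S"
  shows "E \<in> regular_event S \<longleftrightarrow> E' \<in> regular_event S"
  using assms by (simp add: regular_event_def)

text \<open>No vertex pair lies inside both \<open>S\<close> and \<open>S'\<close>.\<close>

lemma regular_events_indep:
  assumes "finite A" "\<And>e. e \<in> A \<Longrightarrow> card e = 2" "finite S" "card (S \<inter> S') \<le> 1"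
  shows "measure_pmf.prob (random_subset A p) (regular_event S \<inter> regular_event S') =
    measure_pmf.prob (random_subset A p) (regular_event S) *
    measure_pmf.prob (random_subset A p) (regular_event S')"
proof -
  let ?T = "{e \<in> A. e \<subseteq> S'}"
  have "measure_pmf.prob (random_subset A p) {E. E \<in> regular_event S \<and> E \<in> regular_event S'} =
    measure_pmf.prob (random_subset A p) {E. E \<in> regular_event S} *
    measure_pmf.prob (random_subset A p) {E. E \<in> regular_event S'}"
  proof (rule random_subset_indep[OF assms(1)])
    show "?T \<subseteq> A" by auto
    show "E \<in> regular_event S \<longleftrightarrow> E - ?T \<in> regular_event S" for E
    proof (rule regular_event_cong)
      have "\<not> e \<subseteq> S" if "e \<in> ?T" for e
        using that assms(2)[of e] assms(4) card_mono[of "S \<inter> S'" e] assms(3) by auto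
      then show "induced_edges E S = induced_edges (E - ?T) S"
        by (auto simp: induced_edges_def)
    qed
    show "E \<in> regular_event S' \<longleftrightarrow> E \<inter> ?T \<in> regular_event S'" if "E \<subseteq> A" for E
      using that by (intro regular_event_cong) (auto simp: induced_edges_def)
  qed
  then show ?thesis by (simp add: Int_def)
qed

text \<open>Fix the common degree \<open>d\<close> in \<open>S'\<close>; there are at most \<open>|S'| + 1\<close> candidates. For \<open>v\<close> in \<open>S' - S\<close> the
number of edges from \<open>v\<close> to \<open>S \<inter> S'\<close> is then determined by the edges inside \<open>S' - S\<close>. The stars from
the vertices \<open>v\<close> to \<open>S \<inter> S'\<close> are disjoint blocks of \<open>|S \<inter> S'|\<close> pairs, none of which lies inside \<open>S\<close>
or inside \<open>S' - S\<close>.\<close>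

lemma regular_overlap_le:
  fixes S S' :: "nat set" and A :: "nat set set"
  assumes "finite A" "0 \<le> a" "a \<le> 1" "\<And>e. e \<in> A \<Longrightarrow> p e \<in> {a..1 - a}"
    and "finite S'" "{e. e \<subseteq> S' \<and> card e = 2} \<subseteq> A"
  shows "measure_pmf.prob (random_subset A p) (regular_event S \<inter> regular_event S') \<le>
    measure_pmf.prob (random_subset A p) (regular_event S) *
    ((real (card S') + 1) * (1 / sqrt (1 + a * real (card (S \<inter> S')))) ^ card (S' - S))"
proof -
  let ?P = "random_subset A p" and ?K = "S \<inter> S'" and ?V = "S' - S"
  let ?b = "1 / sqrt (1 + a * real (card ?K))"
  define T where "T = (\<lambda>v. (\<lambda>u. {u, v}) ` ?K)"
  define Z where "Z = (\<lambda>d. {E. E \<in> regular_event S \<and>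
    (\<forall>v\<in>?V. card (E \<inter> T v) = d - card {u \<in> ?V. {u, v} \<in> E})})"
  have finK: "finite ?K" using assms(5) by auto
  have inj: "inj_on (\<lambda>u. {u, v}) ?K" for v by (auto simp: inj_on_def doubleton_eq_iff)
  have sub: "regular_event S \<inter> regular_event S' \<subseteq> (\<Union>d\<le>card S'. Z d)"
  proof safe
    fix E assume E: "E \<in> regular_event S" "E \<in> regular_event S'"
    then obtain d where d: "\<And>v. v \<in> S' \<Longrightarrow> vdegree S' (induced_edges E S') v = d"
      by (auto simp: regular_event_def regular_graph_def k_regular_def)
    have "\<exists>d\<le>card S'. \<forall>v\<in>?V. vdegree S' (induced_edges E S') v = d"
    \<comment> \<open>For empty \<open>S'\<close> the degree is arbitrary and may be replaced by \<open>0\<close>.\<close>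
    proof (cases "S' = {}")
      case False
      then obtain v where "v \<in> S'" by auto
      then have "d \<le> card S'" using d[of v] assms(5) by (auto simp: vdegree_def intro!: card_mono)
      then show ?thesis using d by auto
    qed auto
    then obtain d where d: "d \<le> card S'" "\<And>v. v \<in> ?V \<Longrightarrow> vdegree S' (induced_edges E S') v = d"
      by auto
    have "card (E \<inter> T v) = d - card {u \<in> ?V. {u, v} \<in> E}" if v: "v \<in> ?V" for v
    proof -
      have "d = card {u \<in> S'. {u, v} \<in> induced_edges E S'}"
        using d(2)[OF v] by (simp add: vdegree_def)
      also have "{u \<in> S'. {u, v} \<in> induced_edges E S'} = {u \<in> ?K. {u, v} \<in> E} \<union> {u \<in> ?V. {u, v} \<in> E}"
        using v by (auto simp: induced_edges_def)
      also have "card \<dots> = card {u \<in> ?K. {u, v} \<in> E} + card {u \<in> ?V. {u, v} \<in> E}"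
        using assms(5) by (intro card_Un_disjoint) auto
      also have "card {u \<in> ?K. {u, v} \<in> E} = card ((\<lambda>u. {u, v}) ` {u \<in> ?K. {u, v} \<in> E})"
        using inj[of v] by (intro card_image[symmetric]) (auto simp: inj_on_def)
      also have "(\<lambda>u. {u, v}) ` {u \<in> ?K. {u, v} \<in> E} = E \<inter> T v"
        by (auto simp: T_def)
      finally show ?thesis by simp
    qed
    then show "E \<in> (\<Union>d\<le>card S'. Z d)" using d(1) E(1) by (auto simp: Z_def)
  qed
  have Z: "measure_pmf.prob ?P (Z d) \<le> measure_pmf.prob ?P (regular_event S) * ?b ^ card ?V" for d
  proof -
    have "measure_pmf.prob ?P (Z d) \<le> measure_pmf.prob ?P {E. E \<in> regular_event S} * ?b ^ card ?V"
      unfolding Z_def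
    proof (rule prob_card_blocks_le[OF _ assms(1-4)])
      show "finite ?V" using assms(5) by auto
      show "T v \<subseteq> A" if "v \<in> ?V" for v
        using that assms(6) by (auto simp: T_def card_insert_if)
      show "card (T v) = card ?K" for v unfolding T_def by (rule card_image[OF inj])
      show "T u \<inter> T v = {}" if "u \<in> ?V" "v \<in> ?V" "u \<noteq> v" for u v
        using that by (auto simp: T_def doubleton_eq_iff)
      show "E \<in> regular_event S \<longleftrightarrow> E - (\<Union>v\<in>?V. T v) \<in> regular_event S" for E
        by (rule regular_event_cong) (auto simp: induced_edges_def T_def)
      show "d - card {u \<in> ?V. {u, v} \<in> E} = d - card {u \<in> ?V. {u, v} \<in> E - (\<Union>v\<in>?V. T v)}"
        if "v \<in> ?V" for v E
      proof -
        have "{u \<in> ?V. {u, v} \<in> E} = {u \<in> ?V. {u, v} \<in> E - (\<Union>v\<in>?V. T v)}"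
          using that by (auto simp: T_def doubleton_eq_iff)
        then show ?thesis by simp
      qed
    qed
    then show ?thesis by simp
  qed
  have "measure_pmf.prob ?P (regular_event S \<inter> regular_event S') \<le> measure_pmf.prob ?P (\<Union>d\<le>card S'. Z d)"
    by (intro measure_pmf.finite_measure_mono sub) auto
  also have "\<dots> \<le> (\<Sum>d\<le>card S'. measure_pmf.prob ?P (Z d))"
    by (intro measure_pmf.finite_measure_subadditive_finite) auto
  also have "\<dots> \<le> (\<Sum>d\<le>card S'. measure_pmf.prob ?P (regular_event S) * ?b ^ card ?V)"
    by (intro sum_mono Z)
  finally show ?thesis by (simp add: algebra_simps)
qed

section \<open>Exponential moments of the overlap of two sets\<close>

lemma card_supersets:
  assumes "finite B" "T \<subseteq> B" "card T \<le> y"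
  shows "card {S. T \<subseteq> S \<and> S \<subseteq> B \<and> card S = y} = (card B - card T) choose (y - card T)"
proof -
  have finT: "finite T" using assms finite_subset by blast
  have "bij_betw (\<lambda>R. T \<union> R) {R. R \<subseteq> B - T \<and> card R = y - card T} {S. T \<subseteq> S \<and> S \<subseteq> B \<and> card S = y}"
  proof (rule bij_betwI[where g = "\<lambda>S. S - T"])
    show "(\<lambda>R. T \<union> R) \<in> {R. R \<subseteq> B - T \<and> card R = y - card T} \<rightarrow> {S. T \<subseteq> S \<and> S \<subseteq> B \<and> card S = y}"
    proof safe
      fix R assume R: "R \<subseteq> B - T" "card R = y - card T"
      then have "finite R" using assms(1) finite_subset by blast
      then show "card (T \<union> R) = y" using R assms(3) finT by (subst card_Un_disjoint) auto
    qed (use assms in auto)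
    show "(\<lambda>S. S - T) \<in> {S. T \<subseteq> S \<and> S \<subseteq> B \<and> card S = y} \<rightarrow> {R. R \<subseteq> B - T \<and> card R = y - card T}"
      using finT by (auto simp: card_Diff_subset)
  qed auto
  then have "card {S. T \<subseteq> S \<and> S \<subseteq> B \<and> card S = y} = card {R. R \<subseteq> B - T \<and> card R = y - card T}"
    by (simp add: bij_betw_same_card)
  also have "\<dots> = card (B - T) choose (y - card T)"
    using assms(1) by (intro n_subsets) auto
  finally show ?thesis using finT assms(2) by (simp add: card_Diff_subset)
qed

lemma binomial_diff_le:
  assumes "t \<le> y" "y \<le> M"
  shows "real ((M - t) choose (y - t)) \<le> real (M choose y) * (real y / real M) ^ t"
  using assms(1)
proof (induction t)
  case 0 then show ?case by simp
next
  case (Suc t)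
  have yt: "y - t = Suc (y - Suc t)" and Mt: "M - t = Suc (M - Suc t)" using Suc.prems assms(2) by auto
  have "Suc (y - Suc t) * (Suc (M - Suc t) choose Suc (y - Suc t)) = Suc (M - Suc t) * ((M - Suc t) choose (y - Suc t))"
    by (rule Suc_times_binomial)
  then have "(y - t) * ((M - t) choose (y - t)) = (M - t) * ((M - Suc t) choose (y - Suc t))"
    by (simp only: yt[symmetric] Mt[symmetric])
  then have "real (y - t) * real ((M - t) choose (y - t)) = real (M - t) * real ((M - Suc t) choose (y - Suc t))"
    by (metis of_nat_mult)
  then have "real ((M - Suc t) choose (y - Suc t)) = real (y - t) / real (M - t) * real ((M - t) choose (y - t))"
    using Suc.prems assms(2) by (simp add: field_simps)
  also have "\<dots> \<le> real y / real M * (real (M choose y) * (real y / real M) ^ t)"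
  proof (intro mult_mono)
    have "real t * real y \<le> real t * real M" using assms(2) by (intro mult_left_mono) auto
    then show "real (y - t) / real (M - t) \<le> real y / real M"
      using Suc.prems assms(2) by (simp add: of_nat_diff field_simps)
  qed (use Suc in auto)
  finally show ?case by (simp add: mult_ac)
qed

text \<open>Expanding \<open>z^|S \<inter> S'|\<close> as the sum of \<open>(z - 1)^|T|\<close> over the subsets \<open>T\<close> of \<open>S \<inter> S'\<close> and exchanging
the sums leaves the number of sets \<open>S'\<close> that contain a given \<open>T\<close>. This is at most the total number
times \<open>(y / M)^|T|\<close>, as if the elements of \<open>S'\<close> were chosen independently.\<close>

lemma sum_power_card_Int_le:
  fixes z :: real
  assumes "finite B" "S \<subseteq> B" "1 \<le> z"
  shows "(\<Sum>S' | S' \<subseteq> B \<and> card S' = card S. z ^ card (S \<inter> S'))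
    \<le> real (card B choose card S) * exp (z * (real (card S))\<^sup>2 / real (card B))"
proof -
  let ?y = "card S" and ?M = "card B"
  let ?F = "{S'. S' \<subseteq> B \<and> card S' = ?y}"
  have finS: "finite S" using assms finite_subset by blast
  have yM: "?y \<le> ?M" using assms by (simp add: card_mono)
  have finF: "finite ?F" using assms(1) by auto
  have expand: "z ^ card (S \<inter> S') = (\<Sum>T\<in>Pow S. if T \<subseteq> S' then (z - 1) ^ card T else 0)" for S'
  proof -
    have "z ^ card (S \<inter> S') = (\<Prod>x\<in>S \<inter> S'. (z - 1) + 1)" by simp
    also have "\<dots> = (\<Sum>T\<in>Pow (S \<inter> S'). (\<Prod>x\<in>T. z - 1) * (\<Prod>x\<in>S \<inter> S' - T. 1))"
      using finS by (intro prod_add) auto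
    also have "\<dots> = (\<Sum>T\<in>Pow (S \<inter> S'). (z - 1) ^ card T)" by simp
    also have "\<dots> = (\<Sum>T\<in>Pow S. if T \<subseteq> S' then (z - 1) ^ card T else 0)"
      using finS by (intro sum.mono_neutral_cong_left) auto
    finally show ?thesis .
  qed
  have "(\<Sum>S'\<in>?F. z ^ card (S \<inter> S')) = (\<Sum>T\<in>Pow S. \<Sum>S'\<in>?F. if T \<subseteq> S' then (z - 1) ^ card T else 0)"
    unfolding expand by (rule sum.swap)
  also have "\<dots> = (\<Sum>T\<in>Pow S. (z - 1) ^ card T * real (card {S'. T \<subseteq> S' \<and> S' \<subseteq> B \<and> card S' = ?y}))"
  proof (rule sum.cong[OF refl])
    fix T
    have "(\<Sum>S'\<in>?F. if T \<subseteq> S' then (z - 1) ^ card T else 0) = (\<Sum>S'\<in>{S'\<in>?F. T \<subseteq> S'}. (z - 1) ^ card T)"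
      using finF by (intro sum.inter_filter[symmetric])
    also have "{S'\<in>?F. T \<subseteq> S'} = {S'. T \<subseteq> S' \<and> S' \<subseteq> B \<and> card S' = ?y}" by auto
    finally show "(\<Sum>S'\<in>?F. if T \<subseteq> S' then (z - 1) ^ card T else 0)
        = (z - 1) ^ card T * real (card {S'. T \<subseteq> S' \<and> S' \<subseteq> B \<and> card S' = ?y})" by simp
  qed
  also have "\<dots> \<le> (\<Sum>T\<in>Pow S. (z - 1) ^ card T * (real (?M choose ?y) * (real ?y / real ?M) ^ card T))"
  proof (intro sum_mono mult_left_mono)
    fix T assume "T \<in> Pow S"
    then have T: "T \<subseteq> B" "card T \<le> ?y" using assms finS by (auto intro: card_mono)
    show "real (card {S'. T \<subseteq> S' \<and> S' \<subseteq> B \<and> card S' = ?y}) \<le> real (?M choose ?y) * (real ?y / real ?M) ^ card T"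
      unfolding card_supersets[OF assms(1) T] by (rule binomial_diff_le[OF T(2) yM])
  qed (use assms(3) in auto)
  also have "\<dots> = real (?M choose ?y) * (\<Sum>T\<in>Pow S. (\<Prod>x\<in>T. (z - 1) * (real ?y / real ?M)) * (\<Prod>x\<in>S - T. 1))"
    by (simp add: sum_distrib_left power_mult_distrib power_divide mult_ac)
  also have "(\<Sum>T\<in>Pow S. (\<Prod>x\<in>T. (z - 1) * (real ?y / real ?M)) * (\<Prod>x\<in>S - T. 1))
      = (\<Prod>x\<in>S. (z - 1) * (real ?y / real ?M) + 1)"
    using finS by (intro prod_add[symmetric])
  also have "\<dots> \<le> (exp (z * (real ?y / real ?M))) ^ ?y"
  proof -
    have "(z - 1) * (real ?y / real ?M) + 1 \<le> z * (real ?y / real ?M) + 1"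
      by (intro add_right_mono mult_right_mono) auto
    also have "\<dots> \<le> exp (z * (real ?y / real ?M))"
      using exp_ge_add_one_self[of "z * (real ?y / real ?M)"] by (simp add: add.commute)
    finally show ?thesis using assms(3) by (simp add: power_mono)
  qed
  also have "\<dots> = exp (z * (real ?y)\<^sup>2 / real ?M)"
    by (simp add: power2_eq_square flip: exp_of_nat_mult)
  finally show ?thesis by (simp add: mult_left_mono)
qed

section \<open>A normalised second moment\<close>

text \<open>Chebyshev's inequality for \<open>\<Sum>\<^sub>S (1(X(S)) / P(X(S)) - 1)\<close>, a sum of centred variables which equals
\<open>- |F|\<close> when no event occurs. Dividing by \<open>P(X(S))\<close> makes the bound depend on correlation ratios only.\<close>

lemma second_moment_normalised:
  fixes P :: "'a pmf" and X :: "'b \<Rightarrow> 'a set"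
  assumes "finite F" "\<And>S. S \<in> F \<Longrightarrow> measure_pmf.prob P (X S) > 0"
  shows "(real (card F))\<^sup>2 * measure_pmf.prob P {E. \<forall>S\<in>F. E \<notin> X S} \<le>
    (\<Sum>S\<in>F. \<Sum>S'\<in>F. measure_pmf.prob P (X S \<inter> X S') /
      (measure_pmf.prob P (X S) * measure_pmf.prob P (X S')) - 1)"
proof -
  let ?p = "\<lambda>S. measure_pmf.prob P (X S)"
  define u where "u = (\<lambda>S E. indicator (X S) E / ?p S - (1::real))"
  have int: "integrable (measure_pmf P) (\<lambda>E. indicator Y E :: real)" for Y
    by (intro measure_pmf.integrable_const_bound[where B = 1]) auto
  have uu: "u S E * u S' E = indicator (X S \<inter> X S') E / (?p S * ?p S') - indicator (X S) E / ?p S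
      - indicator (X S') E / ?p S' + 1" for S S' E
    by (simp add: u_def indicator_inter_arith algebra_simps)
  have int_uu: "integrable (measure_pmf P) (\<lambda>E. u S E * u S' E)" for S S'
    unfolding uu by (intro Bochner_Integration.integrable_add Bochner_Integration.integrable_diff
        integrable_divide_zero int) auto
  have exp_uu: "measure_pmf.expectation P (\<lambda>E. u S E * u S' E) = measure_pmf.prob P (X S \<inter> X S') / (?p S * ?p S') - 1"
    if "S \<in> F" "S' \<in> F" for S S'
    unfolding uu using assms(2)[OF that(1)] assms(2)[OF that(2)]
    by (simp add: int)
  have "(real (card F))\<^sup>2 * measure_pmf.prob P {E. \<forall>S\<in>F. E \<notin> X S}
      = measure_pmf.expectation P (\<lambda>E. (real (card F))\<^sup>2 * indicator {E. \<forall>S\<in>F. E \<notin> X S} E)"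
    by simp
  also have "\<dots> \<le> measure_pmf.expectation P (\<lambda>E. \<Sum>S\<in>F. \<Sum>S'\<in>F. u S E * u S' E)"
  proof (intro integral_mono)
    fix E
    have "(\<Sum>S\<in>F. \<Sum>S'\<in>F. u S E * u S' E) = (\<Sum>S\<in>F. u S E)\<^sup>2"
      by (simp add: power2_eq_square sum_product)
    moreover have "(\<Sum>S\<in>F. u S E) = - real (card F)" if "\<forall>S\<in>F. E \<notin> X S"
      using that by (simp add: u_def sum_negf)
    ultimately show "(real (card F))\<^sup>2 * indicator {E. \<forall>S\<in>F. E \<notin> X S} E \<le> (\<Sum>S\<in>F. \<Sum>S'\<in>F. u S E * u S' E)"
      by (auto simp: indicator_def)
  qed (auto intro!: Bochner_Integration.integrable_sum int_uu integrable_mult_right int)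
  also have "\<dots> = (\<Sum>S\<in>F. \<Sum>S'\<in>F. measure_pmf.expectation P (\<lambda>E. u S E * u S' E))"
    by (simp add: Bochner_Integration.integral_sum int_uu)
  also have "\<dots> = (\<Sum>S\<in>F. \<Sum>S'\<in>F. measure_pmf.prob P (X S \<inter> X S') / (?p S * ?p S') - 1)"
    by (intro sum.cong refl exp_uu)
  finally show ?thesis .
qed

text \<open>The three ranges of \<open>k = |S \<inter> S'|\<close> are merged into a bound that is valid for every \<open>k\<close>, namely a
constant plus two multiples of \<open>k\<close>-th powers, so that the exponential moment of the overlap applies
to each term. The threshold \<open>k1\<close> separates overlaps where \<open>exp (C k\<^sup>2 / y)\<close> is close to \<open>1\<close> from those
that are too large to matter; \<open>\<theta>\<close> is the end of the range of the correlation hypothesis.\<close>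

lemma conditional_failure_le:
  fixes A :: "nat set set" and z \<Lambda> k1 C q \<delta> \<theta> :: real
  assumes A: "finite A" "\<And>e. e \<in> A \<Longrightarrow> card e = 2" "0 \<le> a" "a \<le> 1" "\<And>e. e \<in> A \<Longrightarrow> p e \<in> {a..1 - a}"
    and B: "finite B" "{e. e \<subseteq> B \<and> card e = 2} \<subseteq> A" "1 \<le> y" "y \<le> card B"
    and q: "0 < q" "\<And>S. S \<subseteq> B \<Longrightarrow> card S = y \<Longrightarrow> q \<le> measure_pmf.prob (random_subset A p) (regular_event S)"
    and cor: "0 \<le> C" "\<And>S S'. S \<subseteq> B \<Longrightarrow> S' \<subseteq> B \<Longrightarrow> card S = y \<Longrightarrow> card S' = y \<Longrightarrow>
        2 \<le> card (S \<inter> S') \<Longrightarrow> real (card (S \<inter> S')) \<le> \<theta> \<Longrightarrow>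
        measure_pmf.prob (random_subset A p) (regular_event S \<inter> regular_event S')
          \<le> (1 + \<delta>) * exp (C * (real (card (S \<inter> S')))\<^sup>2 / real y) *
             measure_pmf.prob (random_subset A p) (regular_event S) *
             measure_pmf.prob (random_subset A p) (regular_event S')"
    and large: "1 \<le> z" "0 \<le> \<Lambda>" "\<And>k. k \<le> y \<Longrightarrow> \<theta> < real k \<Longrightarrow>
        (real y + 1) * (1 / sqrt (1 + a * real k)) ^ (y - k) \<le> q * (\<Lambda> * z ^ k)"
    and k1: "0 \<le> k1"
  shows "measure_pmf.prob (random_subset A p) {E. \<forall>S. S \<subseteq> B \<and> card S = y \<longrightarrow> E \<notin> regular_event S}
    \<le> (1 + \<bar>\<delta>\<bar>) * exp (C * k1\<^sup>2 / real y)
      + (1 + \<bar>\<delta>\<bar>) * exp (exp (C + 1) * (real y)\<^sup>2 / real (card B) - k1)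
      + \<Lambda> * exp (z * (real y)\<^sup>2 / real (card B)) - 1"
proof -
  let ?P = "random_subset A p" and ?N = "real (card B choose y)"
  define F where "F = {S. S \<subseteq> B \<and> card S = y}"
  have finF: "finite F" using B(1) by (simp add: F_def)
  have cardF: "card F = card B choose y" unfolding F_def by (rule n_subsets[OF B(1)])
  have N: "0 < ?N" using B(4) by (simp add: zero_less_binomial_iff)
  have pos: "0 < measure_pmf.prob ?P (regular_event S)" if "S \<in> F" for S
    using q(1) q(2)[of S] that by (auto simp: F_def)
  let ?r = "\<lambda>S S'. measure_pmf.prob ?P (regular_event S \<inter> regular_event S') /
      (measure_pmf.prob ?P (regular_event S) * measure_pmf.prob ?P (regular_event S'))"
  let ?d = "1 + \<bar>\<delta>\<bar>"
  define b where "b = (\<lambda>k::nat. ?d * exp (C * k1\<^sup>2 / real y) + ?d * exp (- k1) * exp (C + 1) ^ k + \<Lambda> * z ^ k)"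
  have ratio: "?r S S' \<le> b (card (S \<inter> S'))" if S: "S \<in> F" "S' \<in> F" for S S'
  proof -
    let ?k = "card (S \<inter> S')"
    have S': "S \<subseteq> B" "S' \<subseteq> B" "card S = y" "card S' = y" using S by (auto simp: F_def)
    have fin: "finite S" "finite S'" using S' B(1) finite_subset by blast+
    have k: "?k \<le> y" using S'(3) fin(1) by (metis card_mono inf_le1)
    have nonneg: "0 \<le> ?d * exp (C * k1\<^sup>2 / real y)" "0 \<le> ?d * exp (- k1) * exp (C + 1) ^ ?k" "0 \<le> \<Lambda> * z ^ ?k"
      using large by auto
    consider "?k \<le> 1" | "2 \<le> ?k" "real ?k \<le> \<theta>" | "\<theta> < real ?k" by linarith
    then show ?thesis
    proof cases
      case 1
      then have "?r S S' = 1"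
        using regular_events_indep[OF A(1,2) fin(1) 1, of p] pos[OF S(1)] pos[OF S(2)] by simp
      also have "1 \<le> ?d * exp (C * k1\<^sup>2 / real y)"
        using cor(1) mult_mono[of 1 ?d 1 "exp (C * k1\<^sup>2 / real y)"] by simp
      finally show ?thesis using nonneg unfolding b_def by linarith
    next
      case 2
      have "?r S S' \<le> (1 + \<delta>) * exp (C * (real ?k)\<^sup>2 / real y)"
        using cor(2)[OF S' 2] pos[OF S(1)] pos[OF S(2)] by (simp add: field_simps)
      also have "\<dots> \<le> ?d * exp (C * (real ?k)\<^sup>2 / real y)"
        by (intro mult_right_mono) auto
      also have "\<dots> \<le> b ?k"
      proof (cases "real ?k \<le> k1")
        case True
        then have "?d * exp (C * (real ?k)\<^sup>2 / real y) \<le> ?d * exp (C * k1\<^sup>2 / real y)"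
          using cor(1) by (intro mult_left_mono) (auto intro!: divide_right_mono mult_left_mono power_mono)
        then show ?thesis using nonneg unfolding b_def by linarith
      next
        case False
        \<comment> \<open>Here \<open>C k\<^sup>2 / y \<le> C k\<close> as \<open>k \<le> y\<close>, and \<open>k - k1 > 0\<close> is added to the exponent.\<close>
        have "(real ?k)\<^sup>2 \<le> real ?k * real y"
          using k by (simp add: power2_eq_square mult_left_mono)
        then have "C * (real ?k)\<^sup>2 / real y \<le> C * real ?k"
          using cor(1) B(3) by (simp add: field_simps mult_left_mono)
        also have "\<dots> \<le> real ?k * (C + 1) - k1" using False by (simp add: algebra_simps)
        finally have "?d * exp (C * (real ?k)\<^sup>2 / real y) \<le> ?d * exp (real ?k * (C + 1) - k1)"
          by (intro mult_left_mono) auto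
        also have "\<dots> = ?d * exp (- k1) * exp (C + 1) ^ ?k"
          by (simp add: exp_diff exp_minus field_simps flip: exp_of_nat_mult)
        finally show ?thesis using nonneg unfolding b_def by linarith
      qed
      finally show ?thesis .
    next
      case 3
      have pairs: "{e. e \<subseteq> S' \<and> card e = 2} \<subseteq> A" using B(2) S'(2) by auto
      have card_diff: "card (S' - S) = y - ?k"
        using fin S'(4) by (simp add: card_Diff_subset_Int Int_commute)
      have "measure_pmf.prob ?P (regular_event S \<inter> regular_event S')
          \<le> measure_pmf.prob ?P (regular_event S) * ((real y + 1) * (1 / sqrt (1 + a * real ?k)) ^ (y - ?k))"
        using regular_overlap_le[where p = p and S = S, OF A(1,3,4) A(5) fin(2) pairs] S'(4)
        by (simp add: card_diff)
      also have "\<dots> \<le> measure_pmf.prob ?P (regular_event S) * (q * (\<Lambda> * z ^ ?k))"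
        by (intro mult_left_mono large(3) k 3) auto
      also have "\<dots> \<le> measure_pmf.prob ?P (regular_event S) * (measure_pmf.prob ?P (regular_event S') * (\<Lambda> * z ^ ?k))"
        by (intro mult_left_mono mult_right_mono q(2) S' nonneg) auto
      finally have "?r S S' \<le> \<Lambda> * z ^ ?k"
        using pos[OF S(1)] pos[OF S(2)] by (simp add: field_simps)
      then show ?thesis using nonneg unfolding b_def by linarith
    qed
  qed
  let ?R = "?d * exp (C * k1\<^sup>2 / real y)
      + ?d * exp (exp (C + 1) * (real y)\<^sup>2 / real (card B) - k1) + \<Lambda> * exp (z * (real y)\<^sup>2 / real (card B))"
  have row: "(\<Sum>S'\<in>F. ?r S S' - 1) \<le> ?N * (?R - 1)" if S: "S \<in> F" for S
  proof -
    have S': "S \<subseteq> B" "card S = y" using S by (auto simp: F_def)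
    have mgf: "(\<Sum>S'\<in>F. t ^ card (S \<inter> S')) \<le> ?N * exp (t * (real y)\<^sup>2 / real (card B))" if "1 \<le> t" for t :: real
      using sum_power_card_Int_le[OF B(1) S'(1) that] S'(2) by (simp add: F_def)
    have "(\<Sum>S'\<in>F. ?r S S' - 1) \<le> (\<Sum>S'\<in>F. b (card (S \<inter> S')) - 1)"
      by (intro sum_mono diff_right_mono ratio S)
    also have "\<dots> = ?N * (?d * exp (C * k1\<^sup>2 / real y)) + ?d * exp (- k1) * (\<Sum>S'\<in>F. exp (C + 1) ^ card (S \<inter> S'))
        + \<Lambda> * (\<Sum>S'\<in>F. z ^ card (S \<inter> S')) - ?N"
      by (simp only: b_def sum_subtractf sum.distrib sum_distrib_left sum_constant cardF mult_1_right)
    also have "\<dots> \<le> ?N * (?d * exp (C * k1\<^sup>2 / real y))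
        + ?d * exp (- k1) * (?N * exp (exp (C + 1) * (real y)\<^sup>2 / real (card B)))
        + \<Lambda> * (?N * exp (z * (real y)\<^sup>2 / real (card B))) - ?N"
      using cor(1) large(1,2) by (intro diff_right_mono add_mono mult_left_mono mgf order_refl) auto
    also have "\<dots> = ?N * (?R - 1)"
      by (simp add: algebra_simps exp_diff exp_minus field_simps)
    finally show ?thesis .
  qed
  have "?N\<^sup>2 * measure_pmf.prob ?P {E. \<forall>S\<in>F. E \<notin> regular_event S} \<le> (\<Sum>S\<in>F. \<Sum>S'\<in>F. ?r S S' - 1)"
    using second_moment_normalised[OF finF, of ?P regular_event] pos by (simp add: cardF)
  also have "\<dots> \<le> (\<Sum>S\<in>F. ?N * (?R - 1))" by (intro sum_mono row)
  also have "\<dots> = ?N\<^sup>2 * (?R - 1)" by (simp add: cardF power2_eq_square)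
  finally have "measure_pmf.prob ?P {E. \<forall>S\<in>F. E \<notin> regular_event S} \<le> ?R - 1"
    using N by (simp add: mult_le_cancel_left_pos)
  then show ?thesis by (simp add: F_def Ball_def)
qed

section \<open>The degree sequence at given types\<close>

text \<open>Of two consecutive integers one is even, so the parity condition costs at most one more unit than
rounding up.\<close>

lemma target_degree_bounds:
  assumes "0 \<le> type_mu_avg W x S"
  shows "type_mu_avg W x S \<le> real (target_degree W x S)"
    and "real (target_degree W x S) \<le> type_mu_avg W x S + 2"
proof -
  let ?m = "type_mu_avg W x S"
  let ?Q = "\<lambda>t. ?m \<le> real t \<and> even (t * card S)"
  define t0 where "t0 = nat \<lceil>?m\<rceil>"
  have t0: "?m \<le> real t0" "real t0 \<le> ?m + 1"
    using assms by (auto simp: t0_def of_nat_nat le_of_int_ceiling of_int_ceiling_le_add_one)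
  obtain t where t: "t \<in> {t0, Suc t0}" "even t"
    using that[of t0] that[of "Suc t0"] by (cases "even t0") auto
  have Qt: "?Q t" using t t0 by auto
  show "?m \<le> real (target_degree W x S)"
    using LeastI[of ?Q, OF Qt] unfolding target_degree_def by blast
  have "target_degree W x S \<le> t"
    unfolding target_degree_def by (rule Least_le[of ?Q, OF Qt])
  then have "real (target_degree W x S) \<le> real t" by simp
  then show "real (target_degree W x S) \<le> ?m + 2" using t t0 by auto
qed

text \<open>Adding the diagonal term \<open>W(x\<^sub>v, x\<^sub>v)\<close> makes the sums for different \<open>v\<close> range over the same index
set. Termwise comparison then gives \<open>L w |S|\<close>, the diagonal terms cost \<open>1\<close>, and rounding to the
target degree costs \<open>2\<close>.\<close>

lemma target_degree_deviation:
  assumes S: "finite S" "v \<in> S" and L: "0 \<le> L"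
    and W01: "\<And>u v. u \<in> S \<Longrightarrow> v \<in> S \<Longrightarrow> W (x u) (x v) \<in> {0..1}"
    and W_close: "\<And>u v v'. u \<in> S \<Longrightarrow> v \<in> S \<Longrightarrow> v' \<in> S \<Longrightarrow> \<bar>W (x u) (x v) - W (x u) (x v')\<bar> \<le> L * w"
  shows "\<bar>real (target_degree W x S) - type_mu W x S v\<bar> \<le> L * w * real (card S) + 3"
proof -
  let ?y = "real (card S)" and ?m = "type_mu_avg W x S"
  have y: "0 < ?y" using S by (auto simp: card_gt_0_iff)
  have full: "type_mu W x S v = (\<Sum>u\<in>S. W (x u) (x v)) - W (x v) (x v)" if "v \<in> S" for v
    using S(1) that by (simp add: type_mu_def sum_diff1)
  have dev: "\<bar>type_mu W x S v - type_mu W x S v'\<bar> \<le> L * w * ?y + 1" if v: "v \<in> S" "v' \<in> S" for v v'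
  proof -
    have "\<bar>\<Sum>u\<in>S. W (x u) (x v) - W (x u) (x v')\<bar> \<le> (\<Sum>u\<in>S. \<bar>W (x u) (x v) - W (x u) (x v')\<bar>)"
      by (rule sum_abs)
    also have "\<dots> \<le> (\<Sum>u\<in>S. L * w)" by (intro sum_mono W_close v)
    finally have "\<bar>(\<Sum>u\<in>S. W (x u) (x v)) - (\<Sum>u\<in>S. W (x u) (x v'))\<bar> \<le> L * w * ?y"
      by (simp add: sum_subtractf mult_ac)
    moreover have "W (x v) (x v) \<in> {0..1}" "W (x v') (x v') \<in> {0..1}" using W01 v by blast+
    ultimately show ?thesis unfolding full[OF v(1)] full[OF v(2)] by auto
  qed
  have mu_nonneg: "0 \<le> type_mu W x S u" if "u \<in> S" for u
    unfolding type_mu_def using W01 that by (intro sum_nonneg) (auto simp: atLeastAtMost_iff)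
  have m0: "0 \<le> ?m"
    unfolding type_mu_avg_def by (intro divide_nonneg_nonneg sum_nonneg mu_nonneg) auto
  have "\<bar>?m - type_mu W x S v\<bar> = \<bar>\<Sum>u\<in>S. type_mu W x S u - type_mu W x S v\<bar> / ?y"
    using y by (simp add: type_mu_avg_def sum_subtractf field_simps abs_divide)
  also have "\<dots> \<le> (\<Sum>u\<in>S. \<bar>type_mu W x S u - type_mu W x S v\<bar>) / ?y"
    using y by (intro divide_right_mono sum_abs) auto
  also have "\<dots> \<le> (\<Sum>u\<in>S. L * w * ?y + 1) / ?y"
    using y S(2) by (intro divide_right_mono sum_mono dev) auto
  also have "\<dots> = L * w * ?y + 1" using y by simp
  finally have "\<bar>?m - type_mu W x S v\<bar> \<le> L * w * ?y + 1" .
  then show ?thesis using target_degree_bounds[OF m0] by linarith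
qed

section \<open>The law of the edges and of the types\<close>

lemma edge_law_eq_random_subset:
  "edge_law n W x = random_subset (vertex_pairs n) (\<lambda>e. W (x (Min e)) (x (Max e)))"
  by (simp add: edge_law_def random_subset_def)

lemma pmf_random_subset:
  assumes "finite A" "E \<subseteq> A"
  shows "pmf (random_subset A p) E = (\<Prod>e\<in>A. pmf (bernoulli_pmf (p e)) (e \<in> E))"
proof -
  have "pmf (random_subset A p) (Collect (\<lambda>e. e \<in> E))
      = pmf (Pi_pmf A False (\<lambda>e. bernoulli_pmf (p e))) (\<lambda>e. e \<in> E)"
    unfolding random_subset_def by (rule pmf_map_inj') (auto simp: inj_def Collect_inj)
  also have "\<dots> = (\<Prod>e\<in>A. pmf (bernoulli_pmf (p e)) (e \<in> E))"
    using assms by (intro pmf_Pi') auto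
  finally show ?thesis by simp
qed

lemma finite_vertex_pairs: "finite (vertex_pairs n)"
  by (rule finite_subset[of _ "Pow {1..n}"]) (auto simp: vertex_pairs_def)

lemma vertex_pairs_Min_Max:
  assumes "e \<in> vertex_pairs n"
  shows "Min e \<in> {1..n}" "Max e \<in> {1..n}"
proof -
  have "finite e" "e \<noteq> {}" "e \<subseteq> {1..n}"
    using assms by (auto simp: vertex_pairs_def intro: finite_subset)
  then show "Min e \<in> {1..n}" "Max e \<in> {1..n}" using Min_in[of e] Max_in[of e] by blast+
qed

lemma prob_space_unit_interval: "prob_space (restrict_space lborel {0..1::real})"
  by (rule prob_spaceI) (simp add: space_restrict_space emeasure_restrict_space)

lemma prob_space_type_space: "prob_space (type_space n)"
  unfolding type_space_def by (intro prob_space_PiM prob_space_unit_interval)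

lemma space_type_spaceD: "x \<in> space (type_space n) \<Longrightarrow> i \<in> {1..n} \<Longrightarrow> x i \<in> {0..1}"
  by (auto simp: type_space_def space_PiM PiE_iff space_restrict_space)

lemma measurable_type_coordinate:
  assumes "i \<in> {1..n}"
  shows "(\<lambda>x. x i) \<in> type_space n \<rightarrow>\<^sub>M restrict_space lborel {0..1}"
  unfolding type_space_def by (rule measurable_component_singleton[OF assms])

lemma borel_measurable_type_coordinate:
  assumes "i \<in> {1..n}"
  shows "(\<lambda>x. x i) \<in> borel_measurable (type_space n)"
proof -
  have "(\<lambda>t::real. t) \<in> restrict_space lborel {0..1} \<rightarrow>\<^sub>M borel"
    by (intro measurable_restrict_space1) auto
  from measurable_compose[OF measurable_type_coordinate[OF assms] this] show ?thesis .
qed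

lemma borel_measurable_graphon:
  assumes "continuous_on ({0..1} \<times> {0..1}) (\<lambda>(a, b). W a b :: real)" "i \<in> {1..n}" "j \<in> {1..n}"
  shows "(\<lambda>x. W (x i) (x j)) \<in> borel_measurable (type_space n)"
proof -
  have 1: "(\<lambda>(a, b). W a b) \<in> borel_measurable (restrict_space borel ({0..1} \<times> {0..1}))"
    by (rule borel_measurable_continuous_on_restrict[OF assms(1)])
  have 2: "(\<lambda>x. (x i, x j)) \<in> type_space n \<rightarrow>\<^sub>M restrict_space borel ({0..1} \<times> {0..1})"
  proof (rule measurable_restrict_space2)
    show "(\<lambda>x. (x i, x j)) \<in> space (type_space n) \<rightarrow> {0..1} \<times> {0..1}"
      using space_type_spaceD[of _ n i] space_type_spaceD[of _ n j] assms by blast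
    show "(\<lambda>x. (x i, x j)) \<in> borel_measurable (type_space n)"
      using assms borel_measurable_type_coordinate by (intro borel_measurable_Pair)
  qed
  show ?thesis using measurable_compose[OF 2 1] by simp
qed

text \<open>The edge set takes finitely many values, each with a probability that is a polynomial in the numbers
\<open>W(x\<^sub>i, x\<^sub>j)\<close>.\<close>

lemma measurable_edge_law:
  assumes W: "continuous_on ({0..1} \<times> {0..1}) (\<lambda>(a, b). W a b :: real)"
    and W01: "\<And>a b. a \<in> {0..1} \<Longrightarrow> b \<in> {0..1} \<Longrightarrow> W a b \<in> {0..1}"
  shows "(\<lambda>x. measure_pmf (edge_law n W x)) \<in> type_space n \<rightarrow>\<^sub>M subprob_algebra (count_space UNIV)"
proof (rule measurable_subprob_algebra)
  fix X :: "nat set set set"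
  let ?V = "vertex_pairs n"
  have fin: "finite (X \<inter> Pow ?V)" by (simp add: finite_vertex_pairs)
  have "emeasure (edge_law n W x) X = ennreal (\<Sum>E\<in>X \<inter> Pow ?V. \<Prod>e\<in>?V.
      if e \<in> E then W (x (Min e)) (x (Max e)) else 1 - W (x (Min e)) (x (Max e)))"
    if x: "x \<in> space (type_space n)" for x
  proof -
    have "emeasure (edge_law n W x) X = emeasure (edge_law n W x) (X \<inter> Pow ?V)"
      using set_random_subset[OF finite_vertex_pairs[of n]]
      unfolding edge_law_eq_random_subset by (intro emeasure_eq_AE) (auto simp: AE_measure_pmf_iff)
    also have "\<dots> = ennreal (\<Sum>E\<in>X \<inter> Pow ?V. pmf (edge_law n W x) E)"
      using fin by (simp add: measure_pmf.emeasure_eq_measure measure_measure_pmf_finite)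
    also have "(\<Sum>E\<in>X \<inter> Pow ?V. pmf (edge_law n W x) E) = (\<Sum>E\<in>X \<inter> Pow ?V. \<Prod>e\<in>?V.
      if e \<in> E then W (x (Min e)) (x (Max e)) else 1 - W (x (Min e)) (x (Max e)))"
    proof (rule sum.cong[OF refl])
      fix E assume "E \<in> X \<inter> Pow ?V"
      then have "pmf (edge_law n W x) E = (\<Prod>e\<in>?V. pmf (bernoulli_pmf (W (x (Min e)) (x (Max e)))) (e \<in> E))"
        unfolding edge_law_eq_random_subset by (intro pmf_random_subset finite_vertex_pairs) auto
      also have "\<dots> = (\<Prod>e\<in>?V. if e \<in> E then W (x (Min e)) (x (Max e)) else 1 - W (x (Min e)) (x (Max e)))"
      proof (rule prod.cong[OF refl])
        fix e assume "e \<in> ?V"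
        then have "W (x (Min e)) (x (Max e)) \<in> {0..1}"
          by (intro W01 space_type_spaceD[OF x] vertex_pairs_Min_Max)
        then show "pmf (bernoulli_pmf (W (x (Min e)) (x (Max e)))) (e \<in> E)
            = (if e \<in> E then W (x (Min e)) (x (Max e)) else 1 - W (x (Min e)) (x (Max e)))"
          by auto
      qed
      finally show "pmf (edge_law n W x) E = (\<Prod>e\<in>?V. if e \<in> E then W (x (Min e)) (x (Max e)) else 1 - W (x (Min e)) (x (Max e)))" .
    qed
    finally show ?thesis .
  qed
  moreover have "(\<lambda>x. ennreal (\<Sum>E\<in>X \<inter> Pow ?V. \<Prod>e\<in>?V.
      if e \<in> E then W (x (Min e)) (x (Max e)) else 1 - W (x (Min e)) (x (Max e)))) \<in> borel_measurable (type_space n)"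
  proof (intro measurable_compose[OF _ measurable_ennreal] borel_measurable_sum borel_measurable_prod)
    fix E e assume e: "e \<in> ?V"
    have [measurable]: "(\<lambda>x. W (x (Min e)) (x (Max e))) \<in> borel_measurable (type_space n)"
      by (intro borel_measurable_graphon W vertex_pairs_Min_Max[OF e])
    show "(\<lambda>x. if e \<in> E then W (x (Min e)) (x (Max e)) else 1 - W (x (Min e)) (x (Max e))) \<in> borel_measurable (type_space n)"
      by (cases "e \<in> E") simp_all
  qed
  ultimately show "(\<lambda>x. emeasure (edge_law n W x) X) \<in> borel_measurable (type_space n)"
    by (subst measurable_cong) auto
qed (auto intro: measure_pmf.subprob_space_axioms)

lemma gnW_bounds:
  assumes W: "continuous_on ({0..1} \<times> {0..1}) (\<lambda>(a, b). W a b :: real)"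
    and W01: "\<And>a b. a \<in> {0..1} \<Longrightarrow> b \<in> {0..1} \<Longrightarrow> W a b \<in> {0..1}"
    and G: "G \<in> sets (type_space n)" and r: "0 \<le> r" "\<And>x. x \<in> G \<Longrightarrow> r \<le> measure_pmf.prob (edge_law n W x) X"
  shows "r * measure (type_space n) G \<le> measure (gnW n W) X" "measure (gnW n W) X \<le> 1"
proof -
  interpret T: prob_space "type_space n" by (rule prob_space_type_space)
  note K = measurable_edge_law[OF W W01, of n]
  interpret Q: subprob_space "gnW n W"
    unfolding gnW_def by (rule subprob_space_bind[OF T.subprob_space_axioms K])
  have eq: "emeasure (gnW n W) X = (\<integral>\<^sup>+x. emeasure (edge_law n W x) X \<partial>type_space n)"
    unfolding gnW_def by (rule emeasure_bind[OF T.not_empty K]) auto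
  have "ennreal (r * measure (type_space n) G) = ennreal r * emeasure (type_space n) G"
    using r by (simp add: T.emeasure_eq_measure ennreal_mult)
  also have "\<dots> = (\<integral>\<^sup>+x. ennreal r * indicator G x \<partial>type_space n)"
    using G by (simp add: nn_integral_cmult_indicator)
  also have "\<dots> \<le> (\<integral>\<^sup>+x. emeasure (edge_law n W x) X \<partial>type_space n)"
    using r(2) by (intro nn_integral_mono) (auto simp: indicator_def measure_pmf.emeasure_eq_measure intro: ennreal_leI)
  also have "\<dots> = ennreal (measure (gnW n W) X)"
    by (simp add: eq[symmetric] Q.emeasure_eq_measure)
  finally show "r * measure (type_space n) G \<le> measure (gnW n W) X" by (simp add: ennreal_le_iff)
  show "measure (gnW n W) X \<le> 1" by (rule Q.subprob_measure_le_1)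
qed

lemma indep_vars_type_coordinates:
  assumes "1 \<le> n"
  shows "prob_space.indep_vars (type_space n) (\<lambda>_. restrict_space lborel {0..1}) (\<lambda>i x. x i) {1..n}"
proof -
  let ?I = "{1..n}" and ?U = "restrict_space lborel {0..1::real}"
  interpret T: prob_space "type_space n" by (rule prob_space_type_space)
  have "distr (type_space n) (\<Pi>\<^sub>M i\<in>?I. ?U) (\<lambda>x. restrict x ?I) = distr (type_space n) (type_space n) (\<lambda>x. x)"
    by (intro distr_cong) (auto simp: type_space_def space_PiM PiE_restrict)
  also have "\<dots> = (\<Pi>\<^sub>M i\<in>?I. ?U)" by (simp add: type_space_def)
  also have "\<dots> = (\<Pi>\<^sub>M i\<in>?I. distr (type_space n) ?U (\<lambda>x. x i))"
    unfolding type_space_def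
    by (intro PiM_cong refl distr_PiM_component[symmetric] prob_space_unit_interval)
  finally show ?thesis
    using assms by (subst T.indep_vars_iff_distr_eq_PiM') (auto intro: measurable_type_coordinate)
qed

lemma window_size_concentration:
  assumes n: "1 \<le> n" and w: "0 \<le> w" "0 \<le> c" "c + w \<le> 1"
  defines "G \<equiv> {x \<in> space (type_space n). real n * w / 2 \<le> real (card (window n c w x))}"
  shows "G \<in> sets (type_space n)"
    and "1 - exp (- (real n * w\<^sup>2 / 2)) \<le> measure (type_space n) G"
proof -
  let ?I = "{1..n}" and ?U = "restrict_space lborel {0..1::real}"
  interpret T: prob_space "type_space n" by (rule prob_space_type_space)
  define X where "X = (\<lambda>i (x :: nat \<Rightarrow> real). indicator {c..c + w} (x i) :: real)"
  have card_eq: "real (card (window n c w x)) = (\<Sum>i\<in>?I. X i x)" for x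
    unfolding X_def window_def by (simp add: indicator_def sum.If_cases Int_def)
  have mU: "(\<lambda>t. indicator {c..c + w} t :: real) \<in> borel_measurable ?U"
    by (intro measurable_restrict_space1) auto
  have mX: "X i \<in> borel_measurable (type_space n)" if "i \<in> ?I" for i
    unfolding X_def by (rule measurable_compose[OF measurable_type_coordinate[OF that] mU])
  have expX: "T.expectation (X i) = w" if "i \<in> ?I" for i
  proof -
    have "T.expectation (X i) = integral\<^sup>L (distr (type_space n) ?U (\<lambda>x. x i)) (\<lambda>t. indicator {c..c + w} t)"
      unfolding X_def by (rule integral_distr[OF measurable_type_coordinate[OF that] mU, symmetric])
    also have "distr (type_space n) ?U (\<lambda>x. x i) = ?U"
      unfolding type_space_def using that by (intro distr_PiM_component prob_space_unit_interval)
    also have "integral\<^sup>L ?U (\<lambda>t. indicator {c..c + w} t :: real) = measure ?U ({c..c + w} \<inter> space ?U)"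
      by simp
    also have "{c..c + w} \<inter> space ?U = {c..c + w}" using w by (auto simp: space_restrict_space)
    also have "measure ?U {c..c + w} = w"
      using w by (subst measure_restrict_space) auto
    finally show ?thesis .
  qed
  have indep: "T.indep_vars (\<lambda>_. borel) X ?I"
    unfolding X_def by (rule T.indep_vars_compose2[OF indep_vars_type_coordinates[OF n]]) (use mU in auto)
  interpret H: Hoeffding_ineq "type_space n" ?I X "\<lambda>_. 0" "\<lambda>_. 1" "\<Sum>i\<in>?I. T.expectation (X i)"
  proof unfold_locales
    show "T.indep_vars (\<lambda>_. borel) X ?I" by (rule indep)
    show "AE x in type_space n. X i x \<in> {0..1}" for i by (simp add: X_def indicator_def)
  qed auto
  have sum_meas: "(\<lambda>x. \<Sum>i\<in>?I. X i x) \<in> borel_measurable (type_space n)"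
    by (intro borel_measurable_sum mX)
  show G: "G \<in> sets (type_space n)"
    unfolding G_def card_eq using sum_meas by measurable
  define D where "D = {x \<in> space (type_space n). (\<Sum>i\<in>?I. X i x) \<le> (\<Sum>i\<in>?I. T.expectation (X i)) - real n * w / 2}"
  have D: "D \<in> sets (type_space n)"
    unfolding D_def using sum_meas by measurable
  have "measure (type_space n) D \<le> exp (- 2 * (real n * w / 2)\<^sup>2 / (\<Sum>i\<in>?I. (1 - 0)\<^sup>2))"
    unfolding D_def by (rule H.Hoeffding_ineq_le) (use n w in auto)
  also have "- 2 * (real n * w / 2)\<^sup>2 / (\<Sum>i\<in>?I. (1 - 0)\<^sup>2) = - (real n * w\<^sup>2 / 2)"
    using n by (simp add: power2_eq_square field_simps)
  finally have "measure (type_space n) D \<le> exp (- (real n * w\<^sup>2 / 2))" .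
  moreover have "1 - measure (type_space n) D = measure (type_space n) (space (type_space n) - D)"
    using D by (simp add: T.prob_compl)
  moreover have "measure (type_space n) (space (type_space n) - D) \<le> measure (type_space n) G"
  proof (intro T.finite_measure_mono G)
    have "(\<Sum>i\<in>?I. T.expectation (X i)) = real n * w" using expX by simp
    then show "space (type_space n) - D \<subseteq> G"
      by (auto simp: G_def D_def card_eq mult.commute)
  qed
  ultimately show "1 - exp (- (real n * w\<^sup>2 / 2)) \<le> measure (type_space n) G" by linarith
qed

section \<open>Asymptotic estimates\<close>

text \<open>With \<open>k > y / l\<close> every factor \<open>1 / sqrt (1 + a k)\<close> is at most \<open>sqrt (l / a) / sqrt y\<close>. Out of the
\<open>y\<close> factors \<open>1 / sqrt y\<close> in the lower bound for a single probability, \<open>k\<close> are left over; they are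
written as \<open>(sqrt y N\<^sup>\<epsilon>)\<^sup>k N^(-\<epsilon>k)\<close>, and \<open>N^(-\<epsilon>k) \<le> exp (- \<epsilon> y l)\<close> because \<open>k ln N = k l\<^sup>2 \<ge> y l\<close>.\<close>

lemma large_overlap_weight:
  fixes l a c N \<epsilon> D :: real and y k :: nat
  assumes "1 \<le> y" "k \<le> y" "1 \<le> l" "0 < a" "a < 1" "0 < c" "real y / l < real k"
    and "0 < N" "ln N = l\<^sup>2" "0 \<le> \<epsilon>"
  shows "(real y + 1) * (1 / sqrt (1 + a * real k)) ^ (y - k) \<le>
    ((c / sqrt (real y)) ^ y * exp (- D)) *
    ((real y + 1) * (sqrt (l / a) / c) ^ y * exp (D - \<epsilon> * real y * l) * (sqrt (real y) * N powr \<epsilon>) ^ k)"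
proof -
  define H where "H = sqrt (l / a)"
  define R where "R = sqrt (real y)"
  have H: "1 \<le> H" using assms by (simp add: H_def field_simps)
  have R: "0 < R" using assms by (simp add: R_def)
  have "1 / sqrt (1 + a * real k) \<le> 1 / sqrt (a * (real y / l))"
  proof (intro divide_left_mono)
    have "a * (real y / l) \<le> a * real k" using assms by (intro mult_left_mono) auto
    then show "sqrt (a * (real y / l)) \<le> sqrt (1 + a * real k)" by simp
    show "0 < sqrt (1 + a * real k) * sqrt (a * (real y / l))"
      using assms by (intro mult_pos_pos) (auto simp: add_pos_nonneg)
  qed auto
  also have "\<dots> = H / R"
    using assms by (simp add: H_def R_def real_sqrt_divide real_sqrt_mult)
  finally have "(1 / sqrt (1 + a * real k)) ^ (y - k) \<le> (H / R) ^ (y - k)"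
    using assms by (intro power_mono) auto
  also have "\<dots> \<le> H ^ y / R ^ (y - k)"
    unfolding power_divide using H R by (intro divide_right_mono power_increasing) auto
  also have "\<dots> = H ^ y * R ^ k / R ^ y"
    using R assms(2) by (simp add: power_diff)
  finally have 1: "(1 / sqrt (1 + a * real k)) ^ (y - k) \<le> H ^ y * R ^ k / R ^ y" .
  have "exp (\<epsilon> * real y * l) \<le> (N powr \<epsilon>) ^ k"
  proof -
    have "real y * l \<le> real k * l\<^sup>2"
      using assms(3,7) by (simp add: power2_eq_square field_simps)
    then have "\<epsilon> * (real y * l) \<le> \<epsilon> * (real k * l\<^sup>2)" using assms(10) by (rule mult_left_mono)
    then have "exp (\<epsilon> * real y * l) \<le> exp (real k * (\<epsilon> * ln N))"
      unfolding assms(9) by (simp add: mult_ac)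
    also have "\<dots> = (N powr \<epsilon>) ^ k"
      using assms(8) by (simp add: powr_def exp_of_nat_mult)
    finally show ?thesis .
  qed
  then have 2: "1 \<le> exp (- (\<epsilon> * real y * l)) * (N powr \<epsilon>) ^ k"
    by (simp add: exp_minus field_simps)
  have "(1 / sqrt (1 + a * real k)) ^ (y - k) \<le> H ^ y * R ^ k / R ^ y * (exp (- (\<epsilon> * real y * l)) * (N powr \<epsilon>) ^ k)"
    using 1 mult_left_mono[OF 2, of "H ^ y * R ^ k / R ^ y"] H R by simp
  then have "(real y + 1) * (1 / sqrt (1 + a * real k)) ^ (y - k) \<le>
      (real y + 1) * (H ^ y * R ^ k / R ^ y * (exp (- (\<epsilon> * real y * l)) * (N powr \<epsilon>) ^ k))"
    by (intro mult_left_mono) auto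
  also have "\<dots> = ((c / R) ^ y * exp (- D)) *
    ((real y + 1) * (H / c) ^ y * exp (D - \<epsilon> * real y * l) * (R * N powr \<epsilon>) ^ k)"
    using assms(6) R by (simp add: exp_diff exp_minus power_divide power_mult_distrib field_simps)
  finally show ?thesis by (simp add: H_def R_def)
qed

lemma large_overlap_term_le:
  fixes Y :: nat and b l D z M \<epsilon> r :: real
  assumes "1 \<le> Y" "0 < b" "r \<le> real Y"
    and "ln b + D / real Y + z * real Y / M + 2 \<le> \<epsilon> * l"
  shows "(real Y + 1) * b ^ Y * exp (D - \<epsilon> * real Y * l) * exp (z * (real Y)\<^sup>2 / M) \<le> exp (- r)"
proof -
  have "real Y + 1 \<le> exp (real Y)" by (simp add: add.commute exp_ge_add_one_self)
  moreover have "b ^ Y = exp (real Y * ln b)" using assms by (simp add: exp_of_nat_mult)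
  ultimately have "(real Y + 1) * b ^ Y * exp (D - \<epsilon> * real Y * l) * exp (z * (real Y)\<^sup>2 / M)
      \<le> exp (real Y) * exp (real Y * ln b) * exp (D - \<epsilon> * real Y * l) * exp (z * (real Y)\<^sup>2 / M)"
    by (intro mult_right_mono) auto
  also have "\<dots> = exp (real Y * (ln b + D / real Y + z * real Y / M + 1 - \<epsilon> * l))"
    using assms(1) by (simp add: power2_eq_square algebra_simps flip: exp_add)
  also have "\<dots> \<le> exp (real Y * (- 1))"
    using assms by (intro iffD2[OF exp_le_cancel_iff] mult_left_mono) auto
  also have "\<dots> \<le> exp (- r)" using assms(3) by simp
  finally show ?thesis .
qed

text \<open>The first three limits belong to the three contributions to the failure probability. The fourth
statement makes the window large enough, and the last limit is the failure probability of its size.\<close>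

lemma failure_terms_tendsto:
  fixes \<epsilon> K :: real
  assumes "0 < \<epsilon>" "\<epsilon> < 1/8" 
  shows "(\<lambda>n. exp (K * real n powr (- \<epsilon> / 2))) \<longlonglongrightarrow> 1"
    and "(\<lambda>n. exp (8 * K * real n powr (1/4 - 2 * \<epsilon>) - real n powr (1/4 - 3/4 * \<epsilon>))) \<longlonglongrightarrow> 0"
    and "(\<lambda>n. exp (- (real n powr (1/2 - \<epsilon>)))) \<longlonglongrightarrow> 0"
    and "\<forall>\<^sub>F n in sequentially. 8 * real n powr (1/2 - \<epsilon>) \<le> real n powr (3/4)"
    and "(\<lambda>n. exp (- (real n powr (1/2) / 2))) \<longlonglongrightarrow> 0"
proof -
  show "(\<lambda>n. exp (K * real n powr (- \<epsilon> / 2))) \<longlonglongrightarrow> 1" using assms by real_asymp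
  have "(\<lambda>n. exp (real n powr (1/4 - 3/4 * \<epsilon>) * (8 * K * real n powr (- 5/4 * \<epsilon>) - 1))) \<longlonglongrightarrow> 0"
    using assms by real_asymp
  then show "(\<lambda>n. exp (8 * K * real n powr (1/4 - 2 * \<epsilon>) - real n powr (1/4 - 3/4 * \<epsilon>))) \<longlonglongrightarrow> 0"
    by (simp add: algebra_simps flip: powr_add)
  show "(\<lambda>n. exp (- (real n powr (1/2 - \<epsilon>)))) \<longlonglongrightarrow> 0" using assms by real_asymp
  show "\<forall>\<^sub>F n in sequentially. 8 * real n powr (1/2 - \<epsilon>) \<le> real n powr (3/4)" using assms by real_asymp
  show "(\<lambda>n. exp (- (real n powr (1/2) / 2))) \<longlonglongrightarrow> 0" by real_asymp
qed

text \<open>Here \<open>ln (ln n) / 4\<close> comes from the factor \<open>sqrt (l / a)\<close> with \<open>l = sqrt (ln n)\<close>, the term with \<open>C1\<close>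
from the exponential factor in the local limit hypothesis, and \<open>8 n^(-\<epsilon>/2)\<close> from the exponential moment
of the overlap. Only \<open>ln (ln n)\<close> is unbounded, and it is of smaller order than \<open>sqrt (ln n)\<close>.\<close>

lemma large_overlap_exponent_eventually:
  fixes \<epsilon> K C1 L :: real
  assumes "0 < \<epsilon>" "\<epsilon> < 1/8" 
  shows "\<forall>\<^sub>F n in sequentially. ln (ln (real n)) / 4 + K
    + C1 * (2 * L * real n powr (1/4 - \<epsilon>) + 3)\<^sup>2 / real n powr (1/2 - \<epsilon>) + 8 * real n powr (- \<epsilon> / 2) + 2
    \<le> \<epsilon> * sqrt (ln (real n))"
proof -
  have "(2 * L * real n powr (1/4 - \<epsilon>) + 3) / real n powr (1/4 - \<epsilon> / 2)
      = 2 * L * real n powr (- \<epsilon> / 2) + 3 * real n powr (- (1/4 - \<epsilon> / 2))" for n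
  proof -
    have "real n powr (- \<epsilon> / 2) = real n powr (1/4 - \<epsilon>) / real n powr (1/4 - \<epsilon> / 2)"
      by (simp flip: powr_diff)
    moreover have "real n powr (- (1/4 - \<epsilon> / 2)) = 1 / real n powr (1/4 - \<epsilon> / 2)"
      by (rule powr_minus_divide)
    ultimately show ?thesis by (simp only: add_divide_distrib times_divide_eq_right mult_1_right)
  qed
  moreover have "(\<lambda>n. 2 * L * real n powr (- \<epsilon> / 2) + 3 * real n powr (- (1/4 - \<epsilon> / 2))) \<longlonglongrightarrow> 0"
    using assms by real_asymp
  ultimately have 1: "(\<lambda>n. (2 * L * real n powr (1/4 - \<epsilon>) + 3) / real n powr (1/4 - \<epsilon> / 2)) \<longlonglongrightarrow> 0"
    by simp
  have "(\<lambda>n. C1 * ((2 * L * real n powr (1/4 - \<epsilon>) + 3) / real n powr (1/4 - \<epsilon> / 2))\<^sup>2) \<longlonglongrightarrow> C1 * 0\<^sup>2"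
    by (intro tendsto_intros 1)
  moreover have "(real n powr (1/4 - \<epsilon> / 2))\<^sup>2 = real n powr (1/2 - \<epsilon>)" for n
    by (simp add: power2_eq_square flip: powr_add)
  ultimately have 2: "(\<lambda>n. C1 * (2 * L * real n powr (1/4 - \<epsilon>) + 3)\<^sup>2 / real n powr (1/2 - \<epsilon>)) \<longlonglongrightarrow> 0"
    by (simp add: power_divide)
  have 3: "filterlim (\<lambda>n. \<epsilon> * sqrt (ln (real n)) - (ln (ln (real n)) / 4 + K + 8 * real n powr (- \<epsilon> / 2) + 2)) at_top sequentially"
    using assms by real_asymp
  have "\<forall>\<^sub>F n in sequentially. C1 * (2 * L * real n powr (1/4 - \<epsilon>) + 3)\<^sup>2 / real n powr (1/2 - \<epsilon>) < 1"
    using 2 by (rule order_tendstoD) simp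
  moreover have "\<forall>\<^sub>F n in sequentially. 1 \<le> \<epsilon> * sqrt (ln (real n)) - (ln (ln (real n)) / 4 + K + 8 * real n powr (- \<epsilon> / 2) + 2)"
    using 3 unfolding filterlim_at_top by blast
  ultimately show ?thesis by eventually_elim linarith
qed

section \<open>Large regular induced subgraphs\<close>

text \<open>The failure bound at fixed good types, with its parameters evaluated. The numerical factors come from
\<open>n^(1/2-\<epsilon>) \<le> y \<le> 2 n^(1/2-\<epsilon>)\<close> and \<open>|B| \<ge> n^(3/4) / 2\<close>.\<close>

lemma regular_subset_failure_le:
  fixes n y :: nat and \<epsilon> p0 L C C1 c w c0 \<delta> :: real and x :: "nat \<Rightarrow> real"
  defines "N \<equiv> real n" and "B \<equiv> window n c0 w x"
  assumes \<epsilon>: "0 < \<epsilon>" "\<epsilon> < 1/8" and p0: "0 < p0" "p0 < 1/2" and L: "0 < L"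
    and W_range: "\<And>a b. a \<in> {0..1} \<Longrightarrow> b \<in> {0..1} \<Longrightarrow> W a b \<in> {p0..1 - p0}"
    and W_lip: "\<And>a b b'. a \<in> {0..1} \<Longrightarrow> b \<in> {0..1} \<Longrightarrow> b' \<in> {0..1} \<Longrightarrow> \<bar>W a b - W a b'\<bar> \<le> L * \<bar>b - b'\<bar>"
    and w: "w = N powr (- 1/4)"
    and y: "1 \<le> y" "N powr (1/2 - \<epsilon>) \<le> real y" "real y \<le> 2 * N powr (1/2 - \<epsilon>)"
    and x: "x \<in> space (type_space n)"
    and c: "0 < c" "0 < C1" "0 < C"
    and llt: "\<And>S. S \<subseteq> B \<Longrightarrow> card S = y \<Longrightarrow>
          measure_pmf.prob (edge_law n W x) {E. k_regular (target_degree W x S) S (induced_edges E S)}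
          \<ge> (c / sqrt (real y)) ^ (y - 1) *
             exp (- (C1 / real y) * (\<Sum>v\<in>S. (real (target_degree W x S) - type_mu W x S v)\<^sup>2))"
    and cor: "\<And>S S'. S \<subseteq> B \<Longrightarrow> S' \<subseteq> B \<Longrightarrow> card S = y \<Longrightarrow> card S' = y \<Longrightarrow>
          2 \<le> card (S \<inter> S') \<Longrightarrow> real (card (S \<inter> S')) \<le> real y / sqrt (ln N) \<Longrightarrow>
          measure_pmf.prob (edge_law n W x) (regular_event S \<inter> regular_event S')
          \<le> (1 + \<delta>) * exp (C * (real (card (S \<inter> S')))\<^sup>2 / real y) *
             measure_pmf.prob (edge_law n W x) (regular_event S) *
             measure_pmf.prob (edge_law n W x) (regular_event S')"
    and M: "N * w / 2 \<le> real (card B)"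
    and n: "1 \<le> N" "1 \<le> ln N" "8 * N powr (1/2 - \<epsilon>) \<le> N powr (3/4)"
    and asym: "ln (ln N) / 4 + (- ln p0 / 2 - ln (min c 1))
      + C1 * (2 * L * N powr (1/4 - \<epsilon>) + 3)\<^sup>2 / N powr (1/2 - \<epsilon>) + 8 * N powr (- \<epsilon> / 2) + 2
      \<le> \<epsilon> * sqrt (ln N)"
  shows "measure_pmf.prob (edge_law n W x) {E. \<forall>S. S \<subseteq> B \<and> card S = y \<longrightarrow> E \<notin> regular_event S}
    \<le> (1 + \<bar>\<delta>\<bar>) * exp (C * N powr (- \<epsilon> / 2))
      + (1 + \<bar>\<delta>\<bar>) * exp (8 * exp (C + 1) * N powr (1/4 - 2 * \<epsilon>) - N powr (1/4 - 3/4 * \<epsilon>))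
      + exp (- (N powr (1/2 - \<epsilon>))) - 1"
proof -
  let ?Y = "real y" and ?M = "real (card B)" and ?r = "N powr (1/2 - \<epsilon>)"
  let ?V = "vertex_pairs n" and ?p = "\<lambda>e. W (x (Min e)) (x (Max e))"
  define l where "l = sqrt (ln N)"
  \<comment> \<open>With a constant at most \<open>1\<close> the exponent \<open>y - 1\<close> may be raised to \<open>y\<close>.\<close>
  define c' where "c' = min c 1"
  define b where "b = sqrt (l / p0) / c'"
  define D where "D = C1 * (L * w * ?Y + 3)\<^sup>2"
  define q where "q = (c' / sqrt ?Y) ^ y * exp (- D)"
  define z where "z = sqrt ?Y * N powr \<epsilon>"
  define \<Lambda> where "\<Lambda> = (?Y + 1) * b ^ y * exp (D - \<epsilon> * ?Y * l)"
  define k1 where "k1 = N powr (1/4 - 3/4 * \<epsilon>)"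
  have l: "1 \<le> l" "l\<^sup>2 = ln N" using n by (auto simp: l_def)
  have c': "0 < c'" "c' \<le> 1" "c' \<le> c" using c by (auto simp: c'_def)
  have b: "0 < b" using l c' p0 by (simp add: b_def)
  have Y: "1 \<le> ?Y" using y by simp
  have q0: "0 < q" using c' Y by (auto simp: q_def)
  have N34: "N powr (3/4) / 2 \<le> ?M"
  proof -
    have "N * w = N powr 1 * N powr (- 1/4)" using n by (simp add: w)
    also have "\<dots> = N powr (3/4)" unfolding powr_add[symmetric] by simp
    finally show ?thesis using M by simp
  qed
  have N34pos: "0 < N powr (3/4)" using n by simp
  have finB: "finite B" and B_sub: "B \<subseteq> {1..n}" by (auto simp: B_def window_def)
  have pairs: "{e. e \<subseteq> B \<and> card e = 2} \<subseteq> ?V" using B_sub by (auto simp: vertex_pairs_def)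
  have x01: "x i \<in> {0..1}" if "i \<in> B" for i using space_type_spaceD[OF x] B_sub that by blast
  have x_close: "\<bar>x i - x j\<bar> \<le> w" if "i \<in> B" "j \<in> B" for i j
    using that by (auto simp: B_def window_def)
  have lower: "q \<le> measure_pmf.prob (edge_law n W x) (regular_event S)" if S: "S \<subseteq> B" "card S = y" for S
  proof -
    have finS: "finite S" using S finB finite_subset by blast
    let ?t = "target_degree W x S"
    have dev: "(real ?t - type_mu W x S v)\<^sup>2 \<le> (L * w * ?Y + 3)\<^sup>2" if v: "v \<in> S" for v
    proof -
      have "\<bar>real ?t - type_mu W x S v\<bar> \<le> L * w * real (card S) + 3"
      proof (rule target_degree_deviation[OF finS v])
        show "W (x u) (x v) \<in> {0..1}" if "u \<in> S" "v \<in> S" for u v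
        proof -
          have "W (x u) (x v) \<in> {p0..1 - p0}" using that S(1) by (intro W_range x01) auto
          then show ?thesis using p0 by auto
        qed
        show "\<bar>W (x u) (x v) - W (x u) (x v')\<bar> \<le> L * w" if "u \<in> S" "v \<in> S" "v' \<in> S" for u v v'
        proof -
          have "\<bar>W (x u) (x v) - W (x u) (x v')\<bar> \<le> L * \<bar>x v - x v'\<bar>"
            using that S(1) by (intro W_lip x01) auto
          also have "\<dots> \<le> L * w" using x_close that S(1) L by (intro mult_left_mono) auto
          finally show ?thesis .
        qed
      qed (use L in auto)
      then have "\<bar>real ?t - type_mu W x S v\<bar>\<^sup>2 \<le> (L * w * ?Y + 3)\<^sup>2"
        unfolding S(2) by (rule power_mono) auto
      then show ?thesis by simp
    qed
    have "(\<Sum>v\<in>S. (real ?t - type_mu W x S v)\<^sup>2) \<le> ?Y * (L * w * ?Y + 3)\<^sup>2"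
      using sum_mono[of S, OF dev] S(2) by simp
    then have "C1 / ?Y * (\<Sum>v\<in>S. (real ?t - type_mu W x S v)\<^sup>2) \<le> C1 / ?Y * (?Y * (L * w * ?Y + 3)\<^sup>2)"
      using c by (intro mult_left_mono) auto
    also have "\<dots> = D" using Y by (simp add: D_def)
    finally have e: "exp (- D) \<le> exp (- (C1 / ?Y) * (\<Sum>v\<in>S. (real ?t - type_mu W x S v)\<^sup>2))" by simp
    have "(c' / sqrt ?Y) ^ y \<le> (c' / sqrt ?Y) ^ (y - 1)"
    proof (rule power_decreasing)
      have "c' \<le> sqrt ?Y" using c'(2) Y real_sqrt_ge_one[of ?Y] by linarith
      then show "c' / sqrt ?Y \<le> 1" using Y by (simp add: field_simps)
    qed (use c' in auto)
    also have "\<dots> \<le> (c / sqrt ?Y) ^ (y - 1)"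
      using c' by (intro power_mono divide_right_mono) auto
    finally have "q \<le> (c / sqrt ?Y) ^ (y - 1) * exp (- (C1 / ?Y) * (\<Sum>v\<in>S. (real ?t - type_mu W x S v)\<^sup>2))"
      unfolding q_def using e c by (intro mult_mono) auto
    also have "\<dots> \<le> measure_pmf.prob (edge_law n W x) {E. k_regular ?t S (induced_edges E S)}"
      by (rule llt[OF S])
    also have "\<dots> \<le> measure_pmf.prob (edge_law n W x) (regular_event S)"
      by (intro measure_pmf.finite_measure_mono) (auto simp: regular_event_def regular_graph_def)
    finally show ?thesis .
  qed
  have z: "1 \<le> z"
    using mult_mono[of 1 "sqrt ?Y" 1 "N powr \<epsilon>"] Y n \<epsilon> by (simp add: z_def ge_one_powr_ge_zero)
  have "measure_pmf.prob (edge_law n W x) {E. \<forall>S. S \<subseteq> B \<and> card S = y \<longrightarrow> E \<notin> regular_event S}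
    \<le> (1 + \<bar>\<delta>\<bar>) * exp (C * k1\<^sup>2 / ?Y) + (1 + \<bar>\<delta>\<bar>) * exp (exp (C + 1) * ?Y\<^sup>2 / ?M - k1)
      + \<Lambda> * exp (z * ?Y\<^sup>2 / ?M) - 1"
    unfolding edge_law_eq_random_subset
  proof (rule conditional_failure_le[where a = p0 and q = q and \<theta> = "?Y / l"])
    show "finite ?V" by (rule finite_vertex_pairs)
    show "card e = 2" if "e \<in> ?V" for e using that by (simp add: vertex_pairs_def)
    show "?p e \<in> {p0..1 - p0}" if "e \<in> ?V" for e
      using that by (intro W_range space_type_spaceD[OF x] vertex_pairs_Min_Max)
    have "?Y \<le> ?M" using y(3) n(3) N34 N34pos by linarith
    then show "y \<le> card B" by simp
    show "q \<le> measure_pmf.prob (random_subset ?V ?p) (regular_event S)" if "S \<subseteq> B" "card S = y" for S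
      using lower[OF that] by (simp add: edge_law_eq_random_subset)
    show "measure_pmf.prob (random_subset ?V ?p) (regular_event S \<inter> regular_event S')
          \<le> (1 + \<delta>) * exp (C * (real (card (S \<inter> S')))\<^sup>2 / real y) *
             measure_pmf.prob (random_subset ?V ?p) (regular_event S) *
             measure_pmf.prob (random_subset ?V ?p) (regular_event S')"
      if "S \<subseteq> B" "S' \<subseteq> B" "card S = y" "card S' = y" "2 \<le> card (S \<inter> S')" "real (card (S \<inter> S')) \<le> ?Y / l" for S S'
      using cor[OF that(1-5)] that(6) by (simp add: edge_law_eq_random_subset l_def)
    show "0 \<le> \<Lambda>" using b by (simp add: \<Lambda>_def)
    show "(?Y + 1) * (1 / sqrt (1 + p0 * real k)) ^ (y - k) \<le> q * (\<Lambda> * z ^ k)"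
      if "k \<le> y" "?Y / l < real k" for k
      using large_overlap_weight[OF y(1) that(1) l(1) p0(1) _ c'(1) that(2), of N \<epsilon> D] p0 n l \<epsilon>
      by (simp add: q_def \<Lambda>_def b_def z_def)
  qed (use finB pairs y q0 c z p0 in \<open>auto simp: k1_def\<close>)
  also have "\<dots> \<le> (1 + \<bar>\<delta>\<bar>) * exp (C * N powr (- \<epsilon> / 2))
      + (1 + \<bar>\<delta>\<bar>) * exp (8 * exp (C + 1) * N powr (1/4 - 2 * \<epsilon>) - N powr (1/4 - 3/4 * \<epsilon>))
      + exp (- ?r) - 1"
  proof (intro diff_right_mono add_mono)
    have r0: "0 < ?r" using n by simp
    have "k1\<^sup>2 / ?Y \<le> k1\<^sup>2 / ?r" using y r0 Y by (intro divide_left_mono) auto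
    also have "\<dots> = N powr (- \<epsilon> / 2)"
      by (simp add: k1_def power2_eq_square flip: powr_add powr_diff)
    finally have "C * (k1\<^sup>2 / ?Y) \<le> C * N powr (- \<epsilon> / 2)" using c by (intro mult_left_mono) auto
    then show "(1 + \<bar>\<delta>\<bar>) * exp (C * k1\<^sup>2 / ?Y) \<le> (1 + \<bar>\<delta>\<bar>) * exp (C * N powr (- \<epsilon> / 2))"
      by (intro mult_left_mono) auto
    have "?Y\<^sup>2 / ?M \<le> (2 * ?r)\<^sup>2 / (N powr (3/4) / 2)"
      using y N34 N34pos by (intro frac_le power_mono) auto
    also have "\<dots> = 8 * N powr (1/4 - 2 * \<epsilon>)"
    proof -
      have "N powr (1/2 - \<epsilon>) * N powr (1/2 - \<epsilon>) / N powr (3/4) = N powr (1/4 - 2 * \<epsilon>)"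
        unfolding powr_add[symmetric] powr_diff[symmetric] by simp
      then show ?thesis by (simp add: power2_eq_square)
    qed
    finally have "exp (C + 1) * (?Y\<^sup>2 / ?M) \<le> exp (C + 1) * (8 * N powr (1/4 - 2 * \<epsilon>))"
      by (intro mult_left_mono) auto
    then show "(1 + \<bar>\<delta>\<bar>) * exp (exp (C + 1) * ?Y\<^sup>2 / ?M - k1) \<le>
        (1 + \<bar>\<delta>\<bar>) * exp (8 * exp (C + 1) * N powr (1/4 - 2 * \<epsilon>) - N powr (1/4 - 3/4 * \<epsilon>))"
      by (intro mult_left_mono) (auto simp: k1_def mult_ac)
    have ln_b: "ln b = ln (ln N) / 4 + (- ln p0 / 2 - ln (min c 1))"
    proof -
      have "ln b = (ln l - ln p0) / 2 - ln c'"
        using l p0 c' by (simp add: b_def ln_div ln_sqrt)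
      also have "ln l = ln (ln N) / 2" using n by (simp add: l_def ln_sqrt)
      finally show ?thesis by (simp add: c'_def diff_divide_distrib)
    qed
    \<comment> \<open>Since \<open>w y\<close> is of order \<open>n^(1/4-\<epsilon>)\<close>, its square is of smaller order than \<open>y\<close>.\<close>
    have D_le: "D / ?Y \<le> C1 * (2 * L * N powr (1/4 - \<epsilon>) + 3)\<^sup>2 / ?r"
    proof -
      have "w * ?Y \<le> w * (2 * ?r)" using y by (intro mult_left_mono) (auto simp: w)
      also have "\<dots> = 2 * N powr (1/4 - \<epsilon>)" by (simp add: w flip: powr_add)
      finally have "L * (w * ?Y) \<le> L * (2 * N powr (1/4 - \<epsilon>))" using L by (intro mult_left_mono) auto
      then have "L * w * ?Y + 3 \<le> 2 * L * N powr (1/4 - \<epsilon>) + 3" by (simp add: mult_ac)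
      moreover have "0 \<le> L * w * ?Y + 3" using L by (simp add: w)
      ultimately show ?thesis
        unfolding D_def using c y r0 by (intro frac_le mult_left_mono power_mono) auto
    qed
    have z_le: "z * ?Y / ?M \<le> 8 * N powr (- \<epsilon> / 2)"
    proof -
      have "sqrt ?Y \<le> sqrt (4 * ?r)" using y r0 by (intro real_sqrt_le_mono) linarith
      also have "\<dots> = 2 * N powr (1/4 - \<epsilon> / 2)"
      proof -
        have "4 * ?r = (2 * N powr (1/4 - \<epsilon> / 2))\<^sup>2"
          by (simp add: power2_eq_square flip: powr_add)
        then have "sqrt (4 * ?r) = \<bar>2 * N powr (1/4 - \<epsilon> / 2)\<bar>" by (simp only: real_sqrt_abs)
        then show ?thesis by simp
      qed
      finally have "z \<le> 2 * N powr (1/4 - \<epsilon> / 2) * N powr \<epsilon>"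
        unfolding z_def by (intro mult_right_mono) auto
      then have "z * ?Y / ?M \<le> (2 * N powr (1/4 - \<epsilon> / 2) * N powr \<epsilon> * (2 * ?r)) / (N powr (3/4) / 2)"
        using y N34 N34pos z by (intro frac_le mult_mono) auto
      also have "\<dots> = 8 * N powr (- \<epsilon> / 2)"
      proof -
        have "N powr (1/4 - \<epsilon> / 2) * N powr \<epsilon> * N powr (1/2 - \<epsilon>) / N powr (3/4) = N powr (- \<epsilon> / 2)"
          unfolding powr_add[symmetric] powr_diff[symmetric] by simp
        then show ?thesis by simp
      qed
      finally show ?thesis .
    qed
    show "\<Lambda> * exp (z * ?Y\<^sup>2 / ?M) \<le> exp (- ?r)"
      unfolding \<Lambda>_def
      by (rule large_overlap_term_le[OF y(1) b y(2)]) (use ln_b D_le z_le asym in \<open>auto simp: l_def\<close>)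
  qed
  finally show ?thesis .
qed

lemma max_regular_induced_ge:
  assumes "finite V" "S \<subseteq> V" "E \<in> regular_event S"
  shows "card S \<le> max_regular_induced V E"
  unfolding max_regular_induced_def
proof (rule Max_ge)
  show "finite {card S |S. S \<subseteq> V \<and> regular_graph S (induced_edges E S)}"
    by (rule finite_subset[of _ "card ` Pow V"]) (use assms(1) in auto)
qed (use assms in \<open>auto simp: regular_event_def\<close>)

lemma prob_max_regular_induced_ge:
  fixes P :: "nat set set pmf"
  assumes "finite V" "B \<subseteq> V" "r \<le> real y"
  shows "1 - measure_pmf.prob P {E. \<forall>S. S \<subseteq> B \<and> card S = y \<longrightarrow> E \<notin> regular_event S}
    \<le> measure_pmf.prob P {E. r \<le> real (max_regular_induced V E)}"
proof -
  let ?F = "{E. \<forall>S. S \<subseteq> B \<and> card S = y \<longrightarrow> E \<notin> regular_event S}"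
  have "r \<le> real (max_regular_induced V E)" if E: "E \<notin> ?F" for E
  proof -
    obtain S where S: "S \<subseteq> B" "card S = y" "E \<in> regular_event S" using E by auto
    have "card S \<le> max_regular_induced V E"
      using S assms(2) by (intro max_regular_induced_ge assms(1)) auto
    then show ?thesis using S(2) assms(3) by simp
  qed
  then have "measure_pmf.prob P (UNIV - ?F) \<le> measure_pmf.prob P {E. r \<le> real (max_regular_induced V E)}"
    by (intro measure_pmf.finite_measure_mono) auto
  then show ?thesis
    using measure_pmf.prob_compl[of ?F P] by simp
qed

lemma prob_Int_tendsto_1:
  fixes M :: "nat \<Rightarrow> 'a measure"
  assumes "\<And>n. prob_space (M n)" "\<And>n. A n \<in> sets (M n)" "\<And>n. B n \<in> sets (M n)"
    and "(\<lambda>n. measure (M n) (A n)) \<longlonglongrightarrow> 1" "(\<lambda>n. measure (M n) (B n)) \<longlonglongrightarrow> 1"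
  shows "(\<lambda>n. measure (M n) (A n \<inter> B n)) \<longlonglongrightarrow> 1"
proof (rule tendsto_sandwich)
  have "measure (M n) (A n) + measure (M n) (B n) - 1 \<le> measure (M n) (A n \<inter> B n)" for n
  proof -
    interpret prob_space "M n" by (rule assms)
    have "measure (M n) (A n \<union> B n) = measure (M n) (A n) + measure (M n) (B n) - measure (M n) (A n \<inter> B n)"
      using assms(2,3) by (simp add: finite_measure_Union' finite_measure_Diff' Int_commute)
    then show ?thesis using prob_le_1[of "A n \<union> B n"] by linarith
  qed
  then show "\<forall>\<^sub>F n in sequentially. measure (M n) (A n) + measure (M n) (B n) - 1 \<le> measure (M n) (A n \<inter> B n)"
    by simp
  show "(\<lambda>n. measure (M n) (A n) + measure (M n) (B n) - 1) \<longlonglongrightarrow> 1"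
    using tendsto_diff[OF tendsto_add[OF assms(4,5)] tendsto_const[of 1]] by simp
  show "\<forall>\<^sub>F n in sequentially. measure (M n) (A n \<inter> B n) \<le> 1"
    using assms(1) by (simp add: prob_space.prob_le_1)
qed simp

theorem theorem1p4:
  fixes \<epsilon> p0 L :: real and W :: "real \<Rightarrow> real \<Rightarrow> real"
    and c0 w :: "nat \<Rightarrow> real" and y :: "nat \<Rightarrow> nat"
  assumes "0 < \<epsilon>" and "\<epsilon> < 1/8"
    and "0 < p0" and "p0 < 1/2"
    and W_range: "\<And>a b. a \<in> {0..1} \<Longrightarrow> b \<in> {0..1} \<Longrightarrow> W a b \<in> {p0..1 - p0}"
    and W_sym: "\<And>a b. a \<in> {0..1} \<Longrightarrow> b \<in> {0..1} \<Longrightarrow> W a b = W b a"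
    and W_lipschitz: "L-lipschitz_on ({0..1} \<times> {0..1}) (\<lambda>(a, b). W a b)"
    and L_least: "\<And>L'. L'-lipschitz_on ({0..1} \<times> {0..1}) (\<lambda>(a, b). W a b) \<Longrightarrow> L \<le> L'"
    and "0 < L"
    and w_def: "\<And>n. w n = real n powr (- 1/4)"
    and y_def: "\<And>n. y n = nat \<lceil>real n powr (1/2 - \<epsilon>)\<rceil>"
    and c0_range: "\<And>n. n \<ge> 1 \<Longrightarrow> c0 n \<in> {0..1 - w n}"
    and "LLT W c0 w y"
    and "COR W c0 w y"
  shows "(\<lambda>n. measure (gnW n W)
            {E. real (max_regular_induced {1..n} E) \<ge> real n powr (1/2 - \<epsilon>)}) \<longlonglongrightarrow> 1"
proof -
  let ?P = "\<lambda>n x. measure_pmf.prob (edge_law n W x)"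
  let ?X = "\<lambda>n. {E. real (max_regular_induced {1..n} E) \<ge> real n powr (1/2 - \<epsilon>)}"
  obtain c C1 A1 where c: "0 < c" "0 < C1"
    and A1: "\<forall>n. A1 n \<in> sets (type_space n)" "(\<lambda>n. measure (type_space n) (A1 n)) \<longlonglongrightarrow> 1"
    and llt': "\<forall>n. \<forall>x\<in>A1 n. \<forall>S. S \<subseteq> window n (c0 n) (w n) x \<and> card S = y n \<longrightarrow>
          ?P n x {E. k_regular (target_degree W x S) S (induced_edges E S)}
          \<ge> (c / sqrt (real (y n))) ^ (y n - 1) *
             exp (- (C1 / real (y n)) * (\<Sum>v\<in>S. (real (target_degree W x S) - type_mu W x S v)\<^sup>2))"
    using \<open>LLT W c0 w y\<close> unfolding LLT_def aas_types_def by (elim exE conjE) (rule that)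
  note llt = llt'[rule_format, OF _ conjI]
  obtain C \<delta> A2 where C: "0 < C" and \<delta>: "\<delta> \<longlonglongrightarrow> 0"
    and A2: "\<forall>n. A2 n \<in> sets (type_space n)" "(\<lambda>n. measure (type_space n) (A2 n)) \<longlonglongrightarrow> 1"
    and cor': "\<forall>n. \<forall>x\<in>A2 n. \<forall>S S'. S \<subseteq> window n (c0 n) (w n) x \<and> S' \<subseteq> window n (c0 n) (w n) x \<and>
          card S = y n \<and> card S' = y n \<and> 2 \<le> card (S \<inter> S') \<and>
          real (card (S \<inter> S')) \<le> real (y n) / sqrt (ln (real n)) \<longrightarrow>
          ?P n x (regular_event S \<inter> regular_event S')
          \<le> (1 + \<delta> n) * exp (C * (real (card (S \<inter> S')))\<^sup>2 / real (y n)) *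
             ?P n x (regular_event S) * ?P n x (regular_event S')"
    using \<open>COR W c0 w y\<close> unfolding COR_def aas_types_def by (elim exE conjE) (rule that)
  note cor = cor'[rule_format, OF _ conjI[OF _ conjI[OF _ conjI[OF _ conjI[OF _ conjI]]]]]
  \<comment> \<open>The window lies in \<open>[0, 1]\<close> for \<open>n \<ge> 1\<close>; the value at \<open>n = 0\<close> only keeps \<open>G\<close> measurable.\<close>
  define G where "G = (\<lambda>n. if n = 0 then space (type_space n) else
    {x \<in> space (type_space n). real n * w n / 2 \<le> real (card (window n (c0 n) (w n) x))})"
  have w_cond: "0 \<le> w n" "0 \<le> c0 n" "c0 n + w n \<le> 1" if "1 \<le> n" for n
    using c0_range[OF that] by (auto simp: w_def)
  have G_sets: "G n \<in> sets (type_space n)" for n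
    using window_size_concentration(1)[of n "w n" "c0 n"] w_cond[of n] by (simp add: G_def)
  have G_lim: "(\<lambda>n. measure (type_space n) (G n)) \<longlonglongrightarrow> 1"
  proof (rule tendsto_sandwich)
    have "1 - exp (- (real n powr (1/2) / 2)) \<le> measure (type_space n) (G n)" if "1 \<le> n" for n
    proof -
      have "real n * (w n)\<^sup>2 = real n powr 1 * (real n powr (- 1/4) * real n powr (- 1/4))"
        by (simp add: w_def power2_eq_square)
      also have "\<dots> = real n powr (1/2)" unfolding powr_add[symmetric] by simp
      finally show ?thesis
        using window_size_concentration(2)[OF that w_cond[OF that]] that by (simp add: G_def)
    qed
    then show "\<forall>\<^sub>F n in sequentially. 1 - exp (- (real n powr (1/2) / 2)) \<le> measure (type_space n) (G n)"
      by (auto simp: eventually_sequentially)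
    show "(\<lambda>n. 1 - exp (- (real n powr (1/2) / 2))) \<longlonglongrightarrow> 1"
      using tendsto_diff[OF tendsto_const[of 1] failure_terms_tendsto(5)[OF assms(1,2)]] by simp
    show "\<forall>\<^sub>F n in sequentially. measure (type_space n) (G n) \<le> 1"
      by (simp add: prob_space.prob_le_1 prob_space_type_space)
  qed simp
  define H where "H = (\<lambda>n. A1 n \<inter> A2 n \<inter> G n)"
  have H_sets: "H n \<in> sets (type_space n)" for n
    unfolding H_def by (intro sets.Int A1(1)[rule_format] A2(1)[rule_format] G_sets)
  have H_lim: "(\<lambda>n. measure (type_space n) (H n)) \<longlonglongrightarrow> 1"
    unfolding H_def
    by (intro prob_Int_tendsto_1 sets.Int A1(1)[rule_format] A2(1)[rule_format] A1(2) A2(2) G_sets G_lim prob_space_type_space)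
  define \<eta> where "\<eta> = (\<lambda>n. (1 + \<bar>\<delta> n\<bar>) * exp (C * real n powr (- \<epsilon> / 2))
      + (1 + \<bar>\<delta> n\<bar>) * exp (8 * exp (C + 1) * real n powr (1/4 - 2 * \<epsilon>) - real n powr (1/4 - 3/4 * \<epsilon>))
      + exp (- (real n powr (1/2 - \<epsilon>))) - 1)"
  have "\<eta> \<longlonglongrightarrow> (1 + \<bar>0\<bar>) * 1 + (1 + \<bar>0\<bar>) * 0 + 0 - 1"
    unfolding \<eta>_def by (intro tendsto_intros \<delta> failure_terms_tendsto(1-3)[OF assms(1,2)])
  then have \<eta>: "\<eta> \<longlonglongrightarrow> 0" by simp
  have W01: "W a b \<in> {0..1}" if "a \<in> {0..1}" "b \<in> {0..1}" for a b
    using W_range[OF that] \<open>0 < p0\<close> by auto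
  have W_cont: "continuous_on ({0..1} \<times> {0..1}) (\<lambda>(a, b). W a b)"
    by (rule lipschitz_on_continuous_on[OF W_lipschitz])
  have W_lip: "\<bar>W a b - W a b'\<bar> \<le> L * \<bar>b - b'\<bar>" if "a \<in> {0..1}" "b \<in> {0..1}" "b' \<in> {0..1}" for a b b'
    using lipschitz_onD[OF W_lipschitz, of "(a, b)" "(a, b')"] that by (simp add: dist_real_def dist_Pair_Pair)
  have likely: "1 - \<eta> n \<le> ?P n x (?X n)"
    if n: "1 \<le> real n" "1 \<le> ln (real n)" "8 * real n powr (1/2 - \<epsilon>) \<le> real n powr (3/4)"
      and asym: "ln (ln (real n)) / 4 + (- ln p0 / 2 - ln (min c 1))
        + C1 * (2 * L * real n powr (1/4 - \<epsilon>) + 3)\<^sup>2 / real n powr (1/2 - \<epsilon>) + 8 * real n powr (- \<epsilon> / 2) + 2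
        \<le> \<epsilon> * sqrt (ln (real n))"
      and x: "x \<in> H n" for n x
  proof -
    let ?B = "window n (c0 n) (w n) x"
    let ?F = "{E. \<forall>S. S \<subseteq> ?B \<and> card S = y n \<longrightarrow> E \<notin> regular_event S}"
    have r1: "1 \<le> real n powr (1/2 - \<epsilon>)" using n assms(1,2) by (intro ge_one_powr_ge_zero) auto
    have y: "real n powr (1/2 - \<epsilon>) \<le> real (y n)" "real (y n) \<le> real n powr (1/2 - \<epsilon>) + 1"
      unfolding y_def by (simp_all add: of_nat_nat le_of_int_ceiling of_int_ceiling_le_add_one)
    have x': "x \<in> A1 n" "x \<in> A2 n" "x \<in> G n" using x by (auto simp: H_def)
    have y1: "1 \<le> y n" using y r1 by linarith
    have y2: "real (y n) \<le> 2 * real n powr (1/2 - \<epsilon>)" using y r1 by linarith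
    have xs: "x \<in> space (type_space n)" using x H_sets[of n] sets.sets_into_space by blast
    have M: "real n * w n / 2 \<le> real (card ?B)" using x'(3) n by (auto simp: G_def split: if_splits)
    have "?P n x ?F \<le> \<eta> n"
      unfolding \<eta>_def
      by (rule regular_subset_failure_le[OF assms(1-4) \<open>0 < L\<close> W_range W_lip w_def y1 y(1) y2 xs
            c C llt[OF x'(1)] cor[OF x'(2)] M n asym])
    moreover have "1 - ?P n x ?F \<le> ?P n x (?X n)"
      by (rule prob_max_regular_induced_ge[OF _ _ y(1)]) (auto simp: window_def)
    ultimately show ?thesis by linarith
  qed
  have ev: "\<forall>\<^sub>F n in sequentially. 1 \<le> real n" "\<forall>\<^sub>F n in sequentially. 1 \<le> ln (real n)"
    by (real_asymp, real_asymp)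
  show ?thesis
  proof (rule tendsto_sandwich)
    show "\<forall>\<^sub>F n in sequentially. max 0 (1 - \<eta> n) * measure (type_space n) (H n) \<le> measure (gnW n W) (?X n)"
      using ev failure_terms_tendsto(4)[OF assms(1,2)]
        large_overlap_exponent_eventually[OF assms(1,2), of "- ln p0 / 2 - ln (min c 1)" C1 L]
    proof eventually_elim
      case (elim n)
      show ?case
        by (rule gnW_bounds(1)[OF W_cont W01 H_sets]) (use likely[OF elim] in auto)
    qed
    show "(\<lambda>n. max 0 (1 - \<eta> n) * measure (type_space n) (H n)) \<longlonglongrightarrow> 1"
      using tendsto_mult[OF tendsto_max[OF tendsto_const[of 0] tendsto_diff[OF tendsto_const[of 1] \<eta>]] H_lim] by simp
    show "\<forall>\<^sub>F n in sequentially. measure (gnW n W) (?X n) \<le> 1"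
      by (intro always_eventually allI gnW_bounds(2)[OF W_cont W01 H_sets, of 0]) auto
  qed simp
qed

end
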